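(* Let $(\Omega,\mathcal{C},\Lambda)$ be a naive convex co-compact triple in $\mathbb{P}(\mathbb{R}^d)$. If $A\le\Lambda$ is a maximal Abelian subgroup of $\Lambda$, then there exists a properly embedded simplex $S\subset\mathcal{C}$ such that (1) $S$ is $A$-invariant (i.e. $aS=S$ for all $a\in A$), (2) $A$ acts co-compactly on $S$, and (3) $A$ fixes each vertex of $S$. Moreover, $A$ has a finite index subgroup isomorphic to $\mathbb{Z}^{\dim(S)}$.
   Context: A subset $C\subset\mathbb{P}(\mathbb{R}^d)$ is properly convex if there is an affine chart of $\mathbb{P}(\mathbb{R}^d)$ in which $C$ is a bounded convex set; a properly convex domain is a properly convex set that is open in $\mathbb{P}(\mathbb{R}^d)$. For a properly convex domain $\Omega$, $\mathrm{Aut}(\Omega)=\{g\in\mathrm{PGL}_d(\mathbb{R}): g\Omega=\Omega\}$. A naive convex co-compact triple $(\Omega,\mathcal{C},\Lambda)$ consists of a properly convex domain $\Omega\subset\mathbb{P}(\mathbb{R}^d)$, an infinite discrete subgroup $\Lambda\le\mathrm{Aut}(\Omega)$, and a non-empty closed (in $\Omega$) convex subset $\mathcal{C}\subset\Omega$ with $g\mathcal{C}=\mathcal{C}$ for all $g\in\Lambda$ and $\Lambda\backslash\mathcal{C}$ compact. A subset $S\subset\mathbb{P}(\mathbb{R}^d)$ is a simplex if there exist $g\in\mathrm{PGL}_d(\mathbb{R})$ and $1\le k\le d$ with $gS=\{[x_1:\dots:x_k:0:\dots:0]: x_1>0,\dots,x_k>0\}$; then $\dim S=k-1$ and its vertices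 are the $k$ points $g^{-1}[e_1],\dots,g^{-1}[e_k]$ ($e_i$ the standard basis). For $A\subset B\subset\mathbb{P}(\mathbb{R}^d)$, $A$ is properly embedded in $B$ if the inclusion $A\hookrightarrow B$ is a proper map (subspace topologies). A group $G$ acts co-compactly on a set $X$ if there is a compact $K\subset X$ with $G\cdot K=X$. *)

theory Defs
  imports "HOL-Analysis.Analysis" "HOL-Algebra.Product_Groups" "HOL-Algebra.Elementary_Groups"
begin

definition proj_class :: "'v::real_vector \<Rightarrow> 'v set" where
  "proj_class v = {c *\<^sub>R v | c. c \<noteq> 0}"

definition proj_space :: "'v::real_vector set set" where
  "proj_space = {proj_class v | v. v \<noteq> 0}"

definition proj_top :: "'v::real_normed_vector set topology" where
  "proj_top = topology (\<lambda>U. U \<subseteq> proj_space \<and> open {v. v \<noteq> 0 \<and> proj_class v \<in> U})"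

definition pgl :: "(real^'n^'n) set set" where
  "pgl = {proj_class M | M. invertible M}"

definition pgl_top :: "(real^'n^'n) set topology" where
  "pgl_top = subtopology proj_top pgl"

definition pgl_group :: "(real^'n^'n) set monoid" where
  "pgl_group = \<lparr>carrier = pgl, mult = (\<lambda>g h. {M ** N | M N. M \<in> g \<and> N \<in> h}),
                 one = proj_class (mat 1)\<rparr>"

definition pgl_act :: "(real^'n^'n) set \<Rightarrow> (real^'n) set \<Rightarrow> (real^'n) set" where
  "pgl_act g p = {M *v v | M v. M \<in> g \<and> v \<in> p}"

text \<open>The affine chart complementary to the hyperplane w = 0 is identified with the
  affine hyperplane {v. w \<bullet> v = 1}; the image of C in that chart is its lift.\<close>
definition chart_lift :: "real^'n \<Rightarrow> (real^'n) set set \<Rightarrow> (real^'n) set" where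
  "chart_lift w C = {v. w \<bullet> v = 1 \<and> proj_class v \<in> C}"

definition in_chart_bounded_convex :: "real^'n \<Rightarrow> (real^'n) set set \<Rightarrow> bool" where
  "in_chart_bounded_convex w C \<longleftrightarrow> w \<noteq> 0 \<and> C \<subseteq> proj_space \<and>
     (\<forall>p\<in>C. \<forall>v\<in>p. w \<bullet> v \<noteq> 0) \<and> bounded (chart_lift w C) \<and> convex (chart_lift w C)"

definition properly_convex :: "(real^'n) set set \<Rightarrow> bool" where
  "properly_convex C \<longleftrightarrow> (\<exists>w. in_chart_bounded_convex w C)"

definition properly_convex_domain :: "(real^'n) set set \<Rightarrow> bool" where
  "properly_convex_domain \<Omega> \<longleftrightarrow> properly_convex \<Omega> \<and> openin proj_top \<Omega>"

definition proj_convex_in :: "(real^'n) set set \<Rightarrow> (real^'n) set set \<Rightarrow> bool" where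
  "proj_convex_in \<Omega> C \<longleftrightarrow> C \<subseteq> \<Omega> \<and>
     (\<exists>w. in_chart_bounded_convex w \<Omega> \<and> convex (chart_lift w C))"

definition discrete_subgroup :: "(real^'n^'n) set set \<Rightarrow> bool" where
  "discrete_subgroup \<Lambda> \<longleftrightarrow> subgroup \<Lambda> pgl_group \<and>
     (\<forall>g\<in>\<Lambda>. \<exists>U. openin pgl_top U \<and> U \<inter> \<Lambda> = {g})"

definition acts_cocompactly :: "(real^'n^'n) set set \<Rightarrow> (real^'n) set set \<Rightarrow> bool" where
  "acts_cocompactly G X \<longleftrightarrow>
     (\<exists>K. K \<subseteq> X \<and> compactin proj_top K \<and> (\<Union>g\<in>G. pgl_act g ` K) = X)"

definition naive_cc_triple ::
  "(real^'n) set set \<Rightarrow> (real^'n) set set \<Rightarrow> (real^'n^'n) set set \<Rightarrow> bool" where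
  "naive_cc_triple \<Omega> \<C> \<Lambda> \<longleftrightarrow>
     properly_convex_domain \<Omega> \<and>
     infinite \<Lambda> \<and> discrete_subgroup \<Lambda> \<and> (\<forall>g\<in>\<Lambda>. pgl_act g ` \<Omega> = \<Omega>) \<and>
     \<C> \<noteq> {} \<and> \<C> \<subseteq> \<Omega> \<and> closedin (subtopology proj_top \<Omega>) \<C> \<and> proj_convex_in \<Omega> \<C> \<and>
     (\<forall>g\<in>\<Lambda>. pgl_act g ` \<C> = \<C>) \<and> acts_cocompactly \<Lambda> \<C>"

definition maximal_abelian_subgroup :: "(real^'n^'n) set set \<Rightarrow> (real^'n^'n) set set \<Rightarrow> bool" where
  "maximal_abelian_subgroup A \<Lambda> \<longleftrightarrow>
     subgroup A pgl_group \<and> A \<subseteq> \<Lambda> \<and>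
     (\<forall>a\<in>A. \<forall>b\<in>A. a \<otimes>\<^bsub>pgl_group\<^esub> b = b \<otimes>\<^bsub>pgl_group\<^esub> a) \<and>
     (\<forall>B. subgroup B pgl_group \<and> A \<subseteq> B \<and> B \<subseteq> \<Lambda> \<and>
          (\<forall>a\<in>B. \<forall>b\<in>B. a \<otimes>\<^bsub>pgl_group\<^esub> b = b \<otimes>\<^bsub>pgl_group\<^esub> a) \<longrightarrow> B = A)"

text \<open>S is the image under the projective transformation [M] of the standard open simplex
  spanned by the coordinate vectors indexed by the nonempty set I (so g = [M]^-1 in the paper;
  the choice of I instead of the first k coordinates is immaterial up to permutation matrices).\<close>
definition simplex_rep :: "(real^'n) set set \<Rightarrow> real^'n^'n \<Rightarrow> 'n set \<Rightarrow> bool" where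
  "simplex_rep S M I \<longleftrightarrow> invertible M \<and> I \<noteq> {} \<and>
     S = {proj_class (M *v x) | x. (\<forall>i\<in>I. x $ i > 0) \<and> (\<forall>i. i \<notin> I \<longrightarrow> x $ i = 0)}"

definition simplex_vertices :: "(real^'n) set set \<Rightarrow> (real^'n) set set" where
  "simplex_vertices S = {proj_class (M *v axis i 1) | M I i. simplex_rep S M I \<and> i \<in> I}"

definition properly_embedded :: "(real^'n) set set \<Rightarrow> (real^'n) set set \<Rightarrow> bool" where
  "properly_embedded A B \<longleftrightarrow> A \<subseteq> B \<and>
     proper_map (subtopology proj_top A) (subtopology proj_top B) (\<lambda>x. x)"

end

theory Submission
  imports Defs "HOL-Algebra.FiniteProduct"
begin

text \<open>Lift \<open>\<Omega>\<close> to an open sharp convex cone \<open>Q\<close>, ordered by \<open>closure Q\<close>. For a finite set of lifts of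
  elements of \<open>A\<close> spanning all of them, the vectors \<open>x\<close> over \<open>\<C>\<close> with \<open>l x \<le> a x \<le> m x\<close> form a convex
  cone on which the centralizer of \<open>A\<close>, hence \<open>A\<close> by maximality, acts co-compactly: conjugating \<open>x\<close> into
  a compact set, the conjugates of \<open>a\<close> have bounded displacement there and so are finitely many.
  Inside this cone choose a minimal nonempty \<open>A\<close>-invariant convex cone \<open>Z\<close> that is closed in \<open>Q\<close>. By minimality
  \<open>1 + a\<close> maps \<open>closure Z\<close> onto itself for every \<open>a\<close>, so an extreme ray \<open>e = u + a u\<close> forces \<open>a e\<close> to be
  a multiple of \<open>e\<close>. A basis of extreme rays then spans an invariant simplicial cone, whose interior is
  \<open>Z\<close> by minimality again. The logarithms of the eigenvalue ratios map \<open>A\<close> onto a discrete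
  co-compact group of translations, which gives the finite index lattice.\<close>

section \<open>Sharp convex cones and their automorphisms\<close>

text \<open>Co-compactness on a smaller set does not pass from \<Lambda> to A by itself; maximality
  has to supply it. If g and h carry two points into the compact set and conjugate a spanning set of
  lifts of A in the same way, then h^-1 g centralizes A, so it lies in A. Finitely many conjugation
  patterns thus leave finitely many translates of the compact set. Linear lifts carry a scalar
  ambiguity. Preserving Q makes the scalar positive and comparing determinants makes it 1, so
  commuting classes have commuting lifts. Hence 1 + a commutes with the action and sends an
  invariant cone to an invariant cone, which is where minimality bites. A minimal cone exists
  because every invariant subcone meets the compact set, so chains have nonempty intersection. Cones
  are kept closed only inside Q, since their extreme rays may lie on the boundary of Q. The
  functional w is the one that defines a bounded chart and \<kappa> bounds \<Omega> in that chart: a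
  bound on w x is a bound on the norm of x, the source of the compactness arguments on
  cones.\<close>

locale sharp_cone =
  fixes Q :: "(real^'n) set" and w :: "real^'n" and \<kappa> :: real
  assumes open_Q: "open Q" and convex_Q: "convex Q" and Q_nonempty: "Q \<noteq> {}"
    and scale_Q: "\<And>c x. 0 < c \<Longrightarrow> x \<in> Q \<Longrightarrow> c *\<^sub>R x \<in> Q"
    and pos_Q: "\<And>x. x \<in> Q \<Longrightarrow> 0 < w \<bullet> x"
    and bound_Q: "\<And>x. x \<in> Q \<Longrightarrow> norm x \<le> \<kappa> * (w \<bullet> x)"
begin

lemma kappa_pos: "0 < \<kappa>"
proof -
  obtain x where x: "x \<in> Q" using Q_nonempty by blast
  then have "x \<noteq> 0" using pos_Q by fastforce
  then have "0 < \<kappa> * (w \<bullet> x)" using bound_Q[OF x] by (simp add: order.strict_trans2[of 0 "norm x"])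
  then show ?thesis using pos_Q[OF x] by (simp add: zero_less_mult_iff)
qed

lemma add_Q: "x \<in> Q \<Longrightarrow> y \<in> Q \<Longrightarrow> x + y \<in> Q"
proof -
  assume "x \<in> Q" "y \<in> Q"
  then have "(1/2) *\<^sub>R x + (1/2) *\<^sub>R y \<in> Q" using convexD[OF convex_Q, of x y "1/2" "1/2"] by simp
  from scale_Q[OF _ this, of 2] show ?thesis by (simp add: scaleR_add_right)
qed

lemma closure_bound: "x \<in> closure Q \<Longrightarrow> norm x \<le> \<kappa> * (w \<bullet> x)"
proof -
  have "closed {x. norm x \<le> \<kappa> * (w \<bullet> x)}"
    by (intro closed_Collect_le continuous_intros)
  then have "closure Q \<subseteq> {x. norm x \<le> \<kappa> * (w \<bullet> x)}"
    using bound_Q by (intro closure_minimal) auto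
  then show "x \<in> closure Q \<Longrightarrow> norm x \<le> \<kappa> * (w \<bullet> x)" by auto
qed

lemma closure_nonneg: "x \<in> closure Q \<Longrightarrow> 0 \<le> w \<bullet> x"
  using closure_bound[of x] kappa_pos norm_ge_zero[of x] by (smt (verit) mult_pos_neg)

lemma closure_pos: "x \<in> closure Q \<Longrightarrow> x \<noteq> 0 \<Longrightarrow> 0 < w \<bullet> x"
  using closure_bound[of x] closure_nonneg[of x]
  by (cases "w \<bullet> x = 0") auto

lemma closure_scale: "0 \<le> c \<Longrightarrow> x \<in> closure Q \<Longrightarrow> c *\<^sub>R x \<in> closure Q"
proof -
  assume c: "0 \<le> c" and x: "x \<in> closure Q"
  have zero: "0 \<in> closure Q"
  proof -
    obtain y where y: "y \<in> Q" using Q_nonempty by blast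
    have "(\<lambda>n. (1 / real (Suc n)) *\<^sub>R y) \<longlonglongrightarrow> 0 *\<^sub>R y"
      by (intro tendsto_intros LIMSEQ_Suc lim_1_over_n)
    moreover have "(1 / real (Suc n)) *\<^sub>R y \<in> Q" for n by (intro scale_Q y) simp
    ultimately show ?thesis unfolding closure_sequential scaleR_zero_left by (intro exI conjI allI)
  qed
  show ?thesis
  proof (cases "c = 0")
    case False
    have "(\<lambda>x. c *\<^sub>R x) ` closure Q \<subseteq> closure Q"
      using c False by (intro image_closure_subset continuous_intros closed_closure)
        (auto intro!: subsetD[OF closure_subset] scale_Q)
    then show ?thesis using x by auto
  qed (use zero in auto)
qed

lemma closure_zero: "0 \<in> closure Q"
proof -
  obtain y where "y \<in> Q" using Q_nonempty by blast
  then show ?thesis using closure_scale[of 0 y] closure_subset by auto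
qed

text \<open>Q is open, so the error made by replacing y with a nearby point of Q can be absorbed
  into x.\<close>

lemma add_closure: "x \<in> Q \<Longrightarrow> y \<in> closure Q \<Longrightarrow> x + y \<in> Q"
proof -
  assume x: "x \<in> Q" and y: "y \<in> closure Q"
  obtain e where e: "e > 0" "ball x e \<subseteq> Q" using open_Q x open_contains_ball by blast
  obtain y' where y': "y' \<in> Q" "dist y' y < e" using y e closure_approachable by blast
  have "x + y - y' \<in> ball x e" using y' by (simp add: dist_norm norm_minus_commute)
  then have "(x + y - y') + y' \<in> Q" using e y' by (intro add_Q) auto
  then show ?thesis by simp
qed

lemma closure_add: "x \<in> closure Q \<Longrightarrow> y \<in> closure Q \<Longrightarrow> x + y \<in> closure Q"
proof -
  assume x: "x \<in> closure Q" and y: "y \<in> closure Q"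
  have "(\<lambda>x. x + y) ` closure Q \<subseteq> closure Q"
    using y by (intro image_closure_subset continuous_intros closed_closure)
        (auto intro!: subsetD[OF closure_subset] add_closure)
  then show ?thesis using x by auto
qed

lemma Q_sub: "x \<in> Q \<Longrightarrow> x \<in> closure Q" using closure_subset by auto

lemma closure_sum: "(\<And>i. i \<in> I \<Longrightarrow> f i \<in> closure Q) \<Longrightarrow> sum f I \<in> closure Q"
  by (induction I rule: infinite_finite_induct) (auto simp: closure_zero intro: closure_add)

definition Aut_Q :: "(real^'n^'n) set" where
  "Aut_Q = {M. invertible M \<and> (*v) M ` Q = Q}"

lemma Aut_QD: "M \<in> Aut_Q \<Longrightarrow> x \<in> Q \<Longrightarrow> M *v x \<in> Q" by (auto simp: Aut_Q_def)

lemma Aut_Q_closure: "M \<in> Aut_Q \<Longrightarrow> x \<in> closure Q \<Longrightarrow> M *v x \<in> closure Q"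
proof -
  assume M: "M \<in> Aut_Q" and x: "x \<in> closure Q"
  have "(*v) M ` closure Q \<subseteq> closure Q"
    using M by (intro image_closure_subset closed_closure continuous_on_subset[OF matrix_vector_mult_linear_continuous_on])
       (auto intro!: subsetD[OF closure_subset] Aut_QD)
  then show ?thesis using x by auto
qed

text \<open>A positive map is controlled by its value at one interior point: for small u both x + u
  and x - u lie in Q, so M u is squeezed between -M x and M x in the order of the cone, and
  sharpness turns order bounds into norm bounds. Compactness of K provides one radius e for all
  x.\<close>

lemma operator_bound:
  assumes K: "compact K" "K \<subseteq> Q"
  obtains C where "0 < C"
    "\<And>M x v. M \<in> Aut_Q \<Longrightarrow> x \<in> K \<Longrightarrow> norm (M *v v) \<le> C * norm (M *v x) * norm v"
proof -
  obtain e where e: "e > 0" "(\<Union>x\<in>K. ball x e) \<subseteq> Q"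
    using compact_subset_open_imp_ball_epsilon_subset[OF K(1) open_Q K(2)] by blast
  \<comment> \<open>The factor 2 / e undoes the scaling of v to norm e / 2; the first factor bounds
    M (x + u) through w and adds 1 for the subtraction of M x.\<close>
  define C where "C = (2 * \<kappa> * norm w + 1) * (2 / e)"
  have "0 < C" using e kappa_pos unfolding C_def
    by (intro mult_pos_pos add_nonneg_pos) auto
  moreover have "norm (M *v v) \<le> C * norm (M *v x) * norm v"
    if M: "M \<in> Aut_Q" and x: "x \<in> K" for M x v
  proof (cases "v = 0")
    case False
    define u where "u = (e / 2 / norm v) *\<^sub>R v"
    have nu: "norm u = e / 2" using False e by (simp add: u_def)
    have "x + u \<in> ball x e" "x - u \<in> ball x e" using nu e by (auto simp: dist_norm)
    then have "x + u \<in> Q" "x - u \<in> Q" using e(2) x by blast+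
    then have p: "M *v (x + u) \<in> Q" and m: "M *v (x - u) \<in> Q" using M Aut_QD by auto
    have "norm (M *v (x + u)) \<le> \<kappa> * (w \<bullet> (M *v (x + u)))" by (rule bound_Q[OF p])
    also have "\<dots> \<le> \<kappa> * (w \<bullet> (M *v (x + u)) + w \<bullet> (M *v (x - u)))"
      using pos_Q[OF m] kappa_pos by simp
    also have "\<dots> = 2 * \<kappa> * (w \<bullet> (M *v x))"
      by (simp add: matrix_vector_right_distrib matrix_vector_mult_diff_distrib inner_add_right inner_diff_right)
    also have "\<dots> \<le> 2 * \<kappa> * (norm w * norm (M *v x))"
      using kappa_pos Cauchy_Schwarz_ineq2[of w "M *v x"] by (intro mult_left_mono) auto
    finally have 1: "norm (M *v (x + u)) \<le> 2 * \<kappa> * (norm w * norm (M *v x))" .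
    have "M *v u = M *v (x + u) - M *v x" by (simp add: matrix_vector_right_distrib)
    then have "norm (M *v u) \<le> norm (M *v (x + u)) + norm (M *v x)" by (metis norm_triangle_ineq4)
    with 1 have 2: "norm (M *v u) \<le> (2 * \<kappa> * norm w + 1) * norm (M *v x)" by (simp add: algebra_simps)
    have "v = (2 / e * norm v) *\<^sub>R u" using False e by (simp add: u_def)
    then have "norm (M *v v) = (2 / e * norm v) * norm (M *v u)"
      using e by (metis (no_types, lifting) abs_of_nonneg divide_nonneg_pos matrix_vector_mult_scaleR mult_nonneg_nonneg norm_ge_zero norm_scaleR zero_le_numeral)
    also have "\<dots> \<le> (2 / e * norm v) * ((2 * \<kappa> * norm w + 1) * norm (M *v x))"
      using e 2 by (intro mult_left_mono) auto
    finally show ?thesis by (simp add: C_def mult_ac)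
  qed simp
  ultimately show thesis using that by blast
qed

end

section \<open>Elementary estimates and identities for matrices\<close>

lemma norm_matrix_le:
  fixes M :: "real^'n^'n"
  assumes "\<And>v. norm (M *v v) \<le> B * norm v"
  shows "norm M \<le> real CARD('n) * (real CARD('n) * B)"
proof -
  have ent: "\<bar>M $ i $ j\<bar> \<le> B" for i j
  proof -
    have "M $ i $ j = (M *v axis j 1) $ i" by (simp add: matrix_vector_mul_component inner_axis)
    then have "\<bar>M $ i $ j\<bar> \<le> norm (M *v axis j 1)" by (metis component_le_norm_cart)
    also have "\<dots> \<le> B" using assms[of "axis j 1"] by simp
    finally show ?thesis .
  qed
  have row: "norm (M $ i) \<le> real CARD('n) * B" for i
  proof -
    have "norm (M $ i) \<le> (\<Sum>j\<in>UNIV. \<bar>M $ i $ j\<bar>)" by (rule norm_le_l1_cart)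
    also have "\<dots> \<le> (\<Sum>j\<in>(UNIV::'n set). B)" by (intro sum_mono ent)
    finally show ?thesis by simp
  qed
  have "norm M \<le> (\<Sum>i\<in>UNIV. norm (M $ i))" unfolding norm_vec_def by (rule L2_set_le_sum) simp
  also have "\<dots> \<le> (\<Sum>i\<in>(UNIV::'n set). real CARD('n) * B)" by (intro sum_mono row)
  finally show ?thesis by simp
qed

lemma tendsto_matrix_mult:
  fixes f g :: "_ \<Rightarrow> real^'n^'n"
  assumes "(f \<longlongrightarrow> a) F" "(g \<longlongrightarrow> b) F"
  shows "((\<lambda>x. f x ** g x) \<longlongrightarrow> a ** b) F"
proof (rule vec_tendstoI, rule vec_tendstoI)
  fix i j
  show "((\<lambda>x. (f x ** g x) $ i $ j) \<longlongrightarrow> (a ** b) $ i $ j) F"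
    unfolding matrix_matrix_mult_def by (simp, intro tendsto_intros assms)
qed

lemma matrix_inv_mult [simp]:
  fixes M :: "real^'n^'n"
  assumes "invertible M"
  shows "M ** matrix_inv M = mat 1" "matrix_inv M ** M = mat 1"
    "M *v (matrix_inv M *v v) = v" "matrix_inv M *v (M *v v) = v" "invertible (matrix_inv M)"
proof -
  have "M ** matrix_inv M = mat 1 \<and> matrix_inv M ** M = mat 1"
    using assms unfolding invertible_def matrix_inv_def by (rule someI_ex)
  then show 1: "M ** matrix_inv M = mat 1" and 2: "matrix_inv M ** M = mat 1" by auto
  show "M *v (matrix_inv M *v v) = v" "matrix_inv M *v (M *v v) = v"
    using 1 2 by (simp_all add: matrix_vector_mul_assoc)
  show "invertible (matrix_inv M)" using 1 2 unfolding invertible_def by blast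
qed

context sharp_cone begin

lemma Aut_Q_mult: "M \<in> Aut_Q \<Longrightarrow> N \<in> Aut_Q \<Longrightarrow> M ** N \<in> Aut_Q"
proof -
  assume M: "M \<in> Aut_Q" and N: "N \<in> Aut_Q"
  have "(*v) (M ** N) ` Q = (*v) M ` ((*v) N ` Q)"
    by (simp only: image_image matrix_vector_mul_assoc)
  then show ?thesis using M N by (simp add: Aut_Q_def invertible_mult)
qed

lemma Aut_Q_inv: "M \<in> Aut_Q \<Longrightarrow> matrix_inv M \<in> Aut_Q"
proof -
  assume "M \<in> Aut_Q"
  then have i: "invertible M" and q: "(*v) M ` Q = Q" by (auto simp: Aut_Q_def)
  have "(*v) (matrix_inv M) ` ((*v) M ` Q) = Q" using i by (simp add: image_image)
  then show ?thesis using q i by (simp add: Aut_Q_def)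
qed

text \<open>In terms of the order defined by \<open>closure Q\<close>, the hypothesis reads \<open>l x \<le> M x \<le> m x\<close>;
  it bounds both \<open>M\<close> and its inverse.\<close>
lemma finite_bounded_displacement:
  assumes discrete: "0 < \<delta>" "\<And>M N. M \<in> L \<Longrightarrow> N \<in> L \<Longrightarrow> norm (M ** matrix_inv N - mat 1) < \<delta> \<Longrightarrow> proj_class M = proj_class N"
    and L: "L \<subseteq> Aut_Q" and K: "compact K" "K \<subseteq> Q" and l: "0 < l"
  shows "finite {proj_class M | M. M \<in> L \<and>
    (\<exists>x\<in>K. M *v x - l *\<^sub>R x \<in> closure Q \<and> m *\<^sub>R x - M *v x \<in> closure Q)}" (is "finite ?X")
proof (rule ccontr)
  assume inf: "infinite ?X"
  obtain C where C: "0 < C"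
    "\<And>M x v. M \<in> Aut_Q \<Longrightarrow> x \<in> K \<Longrightarrow> norm (M *v v) \<le> C * norm (M *v x) * norm v"
    using operator_bound[OF K] by blast
  obtain R where R: "\<And>x. x \<in> K \<Longrightarrow> norm x \<le> R" using K(1) compact_imp_bounded bounded_iff by metis
  let ?B = "C * (\<kappa> * (\<bar>m\<bar> * (norm w * R)))" and ?B' = "C * (\<kappa> / l * (norm w * R))"
  have wR: "w \<bullet> x \<le> norm w * R" if "x \<in> K" for x
    using R[OF that] Cauchy_Schwarz_ineq2[of w x] by (smt (verit) mult_left_mono norm_ge_zero)
  have bnd: "norm (M *v v) \<le> ?B * norm v \<and> norm (matrix_inv M *v v) \<le> ?B' * norm v"
    if M: "M \<in> L" and x: "x \<in> K" "M *v x - l *\<^sub>R x \<in> closure Q" "m *\<^sub>R x - M *v x \<in> closure Q" for M x v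
  proof
    have MA: "M \<in> Aut_Q" using M L by blast
    have xQ: "x \<in> Q" using x K by blast
    have "norm (M *v x) \<le> \<kappa> * (w \<bullet> (M *v x))" using MA xQ by (intro bound_Q Aut_QD)
    also have "\<dots> \<le> \<kappa> * (m * (w \<bullet> x))"
      using closure_nonneg[OF x(3)] kappa_pos by (simp add: inner_diff_right)
    also have "\<dots> \<le> \<kappa> * (\<bar>m\<bar> * (norm w * R))"
      using kappa_pos pos_Q[OF xQ] wR[OF x(1)] by (intro mult_left_mono mult_mono) auto
    finally have "norm (M *v x) \<le> \<kappa> * (\<bar>m\<bar> * (norm w * R))" .
    then have "C * norm (M *v x) * norm v \<le> ?B * norm v"
      using C by (intro mult_right_mono mult_left_mono) auto
    then show "norm (M *v v) \<le> ?B * norm v" using C(2)[OF MA x(1), of v] by linarith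
    have iA: "matrix_inv M \<in> Aut_Q" using MA by (rule Aut_Q_inv)
    have inv: "invertible M" using MA by (simp add: Aut_Q_def)
    \<comment> \<open>Applying the inverse to l x \<le> M x turns the lower bound on M into an upper
      bound on the inverse at the same point x.\<close>
    have "matrix_inv M *v (M *v x - l *\<^sub>R x) \<in> closure Q" using iA x(2) by (rule Aut_Q_closure)
    then have "x - l *\<^sub>R (matrix_inv M *v x) \<in> closure Q"
      using inv by (simp add: matrix_vector_mult_diff_distrib matrix_vector_mult_scaleR)
    from closure_nonneg[OF this] have "w \<bullet> (matrix_inv M *v x) \<le> (w \<bullet> x) / l"
      using l by (simp add: inner_diff_right field_simps)
    then have le: "w \<bullet> (matrix_inv M *v x) \<le> (norm w * R) / l"
      using wR[OF x(1)] l by (smt (verit) divide_right_mono)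
    have "norm (matrix_inv M *v x) \<le> \<kappa> * (w \<bullet> (matrix_inv M *v x))"
      using iA xQ by (intro bound_Q Aut_QD)
    also have "\<dots> \<le> \<kappa> * ((norm w * R) / l)"
      using kappa_pos le by (intro mult_left_mono) auto
    finally have "norm (matrix_inv M *v x) \<le> \<kappa> / l * (norm w * R)" by simp
    then have "C * norm (matrix_inv M *v x) * norm v \<le> ?B' * norm v"
      using C by (intro mult_right_mono mult_left_mono) auto
    then show "norm (matrix_inv M *v v) \<le> ?B' * norm v" using C(2)[OF iA x(1), of v] by linarith
  qed
  obtain g :: "nat \<Rightarrow> (real^'n^'n) set" where g: "inj g" "range g \<subseteq> ?X"
    using infinite_countable_subset[OF inf] by blast
  have "\<forall>n. \<exists>M. g n = proj_class M \<and> M \<in> L \<and>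
    (\<exists>x\<in>K. M *v x - l *\<^sub>R x \<in> closure Q \<and> m *\<^sub>R x - M *v x \<in> closure Q)"
  proof
    fix n
    have "g n \<in> ?X" using g(2) by (rule subsetD) (rule rangeI)
    then show "\<exists>M. g n = proj_class M \<and> M \<in> L \<and>
      (\<exists>x\<in>K. M *v x - l *\<^sub>R x \<in> closure Q \<and> m *\<^sub>R x - M *v x \<in> closure Q)"
      by (rule CollectD)
  qed
  then obtain M where M: "\<And>n. g n = proj_class (M n)" "\<And>n. M n \<in> L"
    "\<And>n. \<exists>x\<in>K. M n *v x - l *\<^sub>R x \<in> closure Q \<and> m *\<^sub>R x - M n *v x \<in> closure Q" by metis
  have inv: "invertible (M n)" for n using M(2) L by (auto simp: Aut_Q_def)
  define N where "N n = matrix_inv (M n)" for n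
  have bM: "norm (M n *v v) \<le> ?B * norm v" and bN: "norm (N n *v v) \<le> ?B' * norm v" for n v
  proof -
    obtain x where "x \<in> K" "M n *v x - l *\<^sub>R x \<in> closure Q" "m *\<^sub>R x - M n *v x \<in> closure Q"
      using M(3)[of n] by (elim bexE conjE)
    from bnd[OF M(2) this, of v] show "norm (M n *v v) \<le> ?B * norm v" "norm (N n *v v) \<le> ?B' * norm v"
      unfolding N_def by auto
  qed
  \<comment> \<open>Matrices and inverses have to converge along one subsequence, hence the
    pairs.\<close>
  have "bounded (range (\<lambda>n. (M n, N n)))"
  proof (rule boundedI)
    fix p assume "p \<in> range (\<lambda>n. (M n, N n))"
    then obtain n where p: "p = (M n, N n)" by blast
    show "norm p \<le> real CARD('n) * (real CARD('n) * ?B) + real CARD('n) * (real CARD('n) * ?B')"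
      unfolding p using norm_matrix_le[OF bM, of n] norm_matrix_le[OF bN, of n] norm_Pair_le[of "M n" "N n"]
      by linarith
  qed
  then obtain lim and r :: "nat \<Rightarrow> nat" where r: "strict_mono r" "((\<lambda>n. (M n, N n)) \<circ> r) \<longlonglongrightarrow> lim"
    using bounded_imp_convergent_subsequence by blast
  obtain a b where ab: "lim = (a, b)" by fastforce
  have Ma: "(\<lambda>n. M (r n)) \<longlonglongrightarrow> a" and Nb: "(\<lambda>n. N (r n)) \<longlonglongrightarrow> b"
    using tendsto_fst[OF r(2)] tendsto_snd[OF r(2)] ab by (simp_all add: o_def)
  have "(\<lambda>n. M (r n) ** N (r n)) \<longlonglongrightarrow> a ** b" by (intro tendsto_matrix_mult Ma Nb)
  moreover have "M (r n) ** N (r n) = mat 1" for n using inv by (simp add: N_def)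
  ultimately have "a ** b = mat 1" by (simp add: LIMSEQ_const_iff)
  \<comment> \<open>Quotients of consecutive terms tend to the identity, which discreteness forbids
    for distinct classes.\<close>
  then have "(\<lambda>n. M (r n) ** N (r (Suc n))) \<longlonglongrightarrow> mat 1"
    using tendsto_matrix_mult[OF Ma LIMSEQ_Suc[OF Nb]] by simp
  then have "\<forall>\<^sub>F n in sequentially. dist (M (r n) ** N (r (Suc n))) (mat 1) < \<delta>"
    using discrete(1) tendstoD by blast
  then obtain n where "dist (M (r n) ** N (r (Suc n))) (mat 1) < \<delta>"
    by (meson eventually_happens' sequentially_bot)
  then have "proj_class (M (r n)) = proj_class (M (r (Suc n)))"
    using discrete(2)[OF M(2) M(2)] by (simp add: N_def dist_norm)
  then have "r n = r (Suc n)" using M(1) g(1) by (metis injD)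
  then show False using r(1) by (metis lessI order_less_irrefl strict_mono_less)
qed

end

section \<open>Minimal invariant subcones are simplicial\<close>

text \<open>Completing E to a basis indexed by the coordinates brings an independent set into the
  form that \<open>simplex_rep\<close> asks for: images of some coordinate vectors under one
  invertible matrix.\<close>

lemma matrix_with_columns:
  fixes E :: "(real^'n) set"
  assumes "independent E"
  obtains M :: "real^'n^'n" and I where "invertible M" "E = (\<lambda>i. M *v axis i 1) ` I"
proof -
  obtain B where B: "E \<subseteq> B" "independent B" "UNIV \<subseteq> span B"
    using maximal_independent_subset_extend[of E UNIV] assms by auto
  have fB: "finite B" using B(2) independent_imp_finite by blast
  have "card B = card (UNIV :: 'n set)"
    using basis_card_eq_dim[of B UNIV] B by (simp add: dim_UNIV)
  then obtain h where h: "bij_betw h (UNIV :: 'n set) B"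
    using finite_same_card_bij[OF finite_class.finite_UNIV fB] by auto
  define M :: "real^'n^'n" where "M = (\<chi> r c. h c $ r)"
  have Mx: "M *v x = (\<Sum>i\<in>UNIV. (x $ i) *\<^sub>R h i)" for x
    by (simp add: M_def matrix_vector_mult_def vec_eq_iff mult.commute)
  have "surj ((*v) M)"
  proof -
    have "y \<in> range ((*v) M)" for y
    proof -
      obtain u where "y = (\<Sum>v\<in>B. u v *\<^sub>R v)" using B(3) span_finite[OF fB] by blast
      also have "\<dots> = (\<Sum>i\<in>UNIV. u (h i) *\<^sub>R h i)"
        using sum.reindex_bij_betw[OF h, of "\<lambda>v. u v *\<^sub>R v"] by simp
      also have "\<dots> = M *v (\<chi> i. u (h i))" by (simp add: Mx)
      finally show ?thesis by blast
    qed
    then show ?thesis by blast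
  qed
  then have "invertible M" using invertible_right_inverse matrix_right_invertible_surjective by blast
  moreover have "M *v axis i 1 = h i" for i
    by (simp add: M_def vec_eq_iff matrix_vector_mul_component inner_axis)
  moreover have "E = h ` {i. h i \<in> E}" using B(1) h unfolding bij_betw_def by blast
  ultimately show thesis using that[of M "{i. h i \<in> E}"] by simp
qed

lemma matrix_vector_sum_axis: "M *v x = (\<Sum>i\<in>UNIV. (x $ i) *\<^sub>R (M *v axis i 1))" for M :: "real^'n^'n"
  by (simp add: vec_eq_iff matrix_vector_mult_def sum_distrib_left axis_def if_distrib cong: if_cong)
     (simp add: mult.commute)

definition open_orthant :: "'n set \<Rightarrow> (real^'n) set" where
  "open_orthant I = {x. (\<forall>i\<in>I. x $ i > 0) \<and> (\<forall>i. i \<notin> I \<longrightarrow> x $ i = 0)}"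

context sharp_cone begin

text \<open>Closedness is relative to Q, which corresponds to closedness in \<Omega> of the
  projective image and ultimately gives the proper embedding.\<close>

definition invariant_subcone :: "(real^'n^'n) set \<Rightarrow> (real^'n) set \<Rightarrow> bool" where
  "invariant_subcone P Z \<longleftrightarrow> Z \<noteq> {} \<and> Z \<subseteq> Q \<and> convex Z \<and> (\<forall>c>0. \<forall>x\<in>Z. c *\<^sub>R x \<in> Z) \<and>
     Q \<inter> closure Z \<subseteq> Z \<and> (\<forall>M\<in>P. \<forall>x\<in>Z. M *v x \<in> Z)"

definition minimal_subcone :: "(real^'n^'n) set \<Rightarrow> (real^'n) set \<Rightarrow> bool" where
  "minimal_subcone P Z \<longleftrightarrow> invariant_subcone P Z \<and> (\<forall>Z'. invariant_subcone P Z' \<and> Z' \<subseteq> Z \<longrightarrow> Z' = Z)"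

lemma invariant_subconeI:
  assumes "x \<in> Q" "x \<in> D" "closed D" "convex D" "\<And>c x. 0 < c \<Longrightarrow> x \<in> D \<Longrightarrow> c *\<^sub>R x \<in> D"
    "\<And>M x. M \<in> P \<Longrightarrow> x \<in> D \<Longrightarrow> M *v x \<in> D" "P \<subseteq> Aut_Q"
  shows "invariant_subcone P (Q \<inter> D)"
proof -
  have "closure (Q \<inter> D) \<subseteq> D" using assms(3) by (intro closure_minimal) auto
  then show ?thesis using assms unfolding invariant_subcone_def
    by (auto intro: convex_Int convex_Q scale_Q Aut_QD)
qed

text \<open>Zorn's lemma for reversed inclusion. With any point z an invariant subcone contains a
  translate of z in K, so the finite intersection property keeps the intersection of a chain
  nonempty.\<close>

lemma exists_minimal_subcone:
  assumes Y: "invariant_subcone P Y" and K: "compact K" "K \<subseteq> Y"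
    and cocompact: "\<And>y. y \<in> Y \<Longrightarrow> \<exists>M\<in>P. M *v y \<in> K"
  obtains Z where "minimal_subcone P Z" "Z \<subseteq> Y"
proof -
  define A where "A = {Z. invariant_subcone P Z \<and> Z \<subseteq> Y}"
  have meets: "Z \<inter> K \<noteq> {}" if "Z \<in> A" for Z
  proof -
    have Z: "invariant_subcone P Z" "Z \<subseteq> Y" using that by (auto simp: A_def)
    then obtain z where z: "z \<in> Z" by (auto simp: invariant_subcone_def)
    then obtain M where "M \<in> P" "M *v z \<in> K" using cocompact Z by blast
    moreover have "M *v z \<in> Z" using Z(1) z \<open>M \<in> P\<close> by (auto simp: invariant_subcone_def)
    ultimately show ?thesis by blast
  qed
  have KQ: "K \<subseteq> Q" using K Y by (auto simp: invariant_subcone_def)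
  have "\<exists>m\<in>A. \<forall>a\<in>A. a \<subseteq> m \<longrightarrow> a = m"
  proof (rule predicate_Zorn[where P = "\<lambda>a b. b \<subseteq> a"])
    show "partial_order_on A (relation_of (\<lambda>a b. b \<subseteq> a) A)"
      by (auto simp: partial_order_on_def preorder_on_def relation_of_def refl_on_def trans_def antisym_def)
  next
    fix C assume "C \<in> Chains (relation_of (\<lambda>a b. b \<subseteq> a) A)"
    then have C: "C \<subseteq> A" "\<And>a b. a \<in> C \<Longrightarrow> b \<in> C \<Longrightarrow> a \<subseteq> b \<or> b \<subseteq> a"
      unfolding Chains_def relation_of_def by blast+
    show "\<exists>u\<in>A. \<forall>a\<in>C. u \<subseteq> a"
    proof (cases "C = {}")
      case True
      then show ?thesis using Y by (auto simp: A_def)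
    next
      case False
      \<comment> \<open>The compactness argument needs closed sets, hence the closures; K lies in Q,
        where each closure adds nothing to its cone.\<close>
      have "K \<inter> \<Inter>(closure ` C) \<noteq> {}"
      proof (rule compact_imp_fip[OF K(1)])
        show "closed T" if "T \<in> closure ` C" for T using that by auto
        fix F assume F: "finite F" "F \<subseteq> closure ` C"
        obtain C' where C': "C' \<subseteq> C" "finite C'" "F = closure ` C'"
          using finite_subset_image[OF F] by blast
        show "K \<inter> \<Inter>F \<noteq> {}"
        proof (cases "C' = {}")
          case True
          then show ?thesis using C' meets[of Y] Y by (auto simp: A_def)
        next
          case False
          obtain m where m: "m \<in> C'" "\<forall>b\<in>C'. b \<le> m \<longrightarrow> m = b"
            using finite_has_minimal[OF C'(2) False] by blast
          then have "m \<subseteq> b" if "b \<in> C'" for b using C(2)[of m b] C'(1) that by blast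
          then have "m \<subseteq> \<Inter>F" using C'(3) closure_subset by fast
          moreover have "m \<inter> K \<noteq> {}" using meets m C' C by blast
          ultimately show ?thesis by blast
        qed
      qed
      then obtain x where x: "x \<in> K" "\<And>Z. Z \<in> C \<Longrightarrow> x \<in> closure Z" by blast
      have inv: "invariant_subcone P Z" if "Z \<in> C" for Z using C that by (auto simp: A_def)
      have "x \<in> \<Inter>C" using x KQ inv unfolding invariant_subcone_def by blast
      moreover have "\<Inter>C \<subseteq> Y" using False C(1) by (fastforce simp: A_def)
      moreover have "\<Inter>C \<subseteq> Q" using \<open>\<Inter>C \<subseteq> Y\<close> Y by (auto simp: invariant_subcone_def)
      moreover have "convex (\<Inter>C)" using inv by (intro convex_Inter) (auto simp: invariant_subcone_def)
      moreover have "Q \<inter> closure (\<Inter>C) \<subseteq> \<Inter>C"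
      proof
        fix y assume y: "y \<in> Q \<inter> closure (\<Inter>C)"
        have "y \<in> Z" if "Z \<in> C" for Z
        proof -
          have "closure (\<Inter>C) \<subseteq> closure Z" using that by (intro closure_mono) auto
          then show ?thesis using y inv[OF that] by (auto simp: invariant_subcone_def)
        qed
        then show "y \<in> \<Inter>C" by blast
      qed
      ultimately have "\<Inter>C \<in> A" using inv by (auto simp: A_def invariant_subcone_def)
      then show ?thesis by blast
    qed
  qed
  then obtain Z where Z: "Z \<in> A" "\<And>a. a \<in> A \<Longrightarrow> a \<subseteq> Z \<Longrightarrow> a = Z" by blast
  then have "minimal_subcone P Z" "Z \<subseteq> Y"
    unfolding minimal_subcone_def by (auto simp: A_def)
  then show thesis using that by blast
qed

lemma closure_subcone:
  assumes Z: "invariant_subcone P Z"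
  shows "closure Z \<subseteq> closure Q" "Q \<inter> closure Z = Z" "convex (closure Z)"
    "0 \<le> c \<Longrightarrow> x \<in> closure Z \<Longrightarrow> c *\<^sub>R x \<in> closure Z"
    "x \<in> closure Z \<Longrightarrow> y \<in> closure Z \<Longrightarrow> x + y \<in> closure Z"
    "M \<in> P \<Longrightarrow> x \<in> closure Z \<Longrightarrow> M *v x \<in> closure Z"
proof -
  have z: "Z \<subseteq> Q" "convex Z" "\<And>c x. 0 < c \<Longrightarrow> x \<in> Z \<Longrightarrow> c *\<^sub>R x \<in> Z" "Q \<inter> closure Z \<subseteq> Z"
    "\<And>M x. M \<in> P \<Longrightarrow> x \<in> Z \<Longrightarrow> M *v x \<in> Z" "Z \<noteq> {}"
    using Z unfolding invariant_subcone_def by auto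
  have sub: "x \<in> Z \<Longrightarrow> x \<in> closure Z" for x using closure_subset by auto
  show "closure Z \<subseteq> closure Q" using z(1) by (rule closure_mono)
  show "Q \<inter> closure Z = Z" using z sub by blast
  show conv: "convex (closure Z)" using z(2) by (rule convex_closure)
  have sc: "c *\<^sub>R x \<in> closure Z" if c: "0 < c" and x: "x \<in> closure Z" for c x
  proof -
    have "(\<lambda>x. c *\<^sub>R x) ` closure Z \<subseteq> closure Z"
      using c by (intro image_closure_subset continuous_intros closed_closure) (auto intro!: sub z)
    then show ?thesis using x by auto
  qed
  obtain y where y: "y \<in> Z" using z by blast
  have "0 \<in> closure Z"
  proof -
    have "(\<lambda>n. (1 / real (Suc n)) *\<^sub>R y) \<longlonglongrightarrow> 0 *\<^sub>R y"
      by (intro tendsto_intros LIMSEQ_Suc lim_1_over_n)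
    moreover have "(1 / real (Suc n)) *\<^sub>R y \<in> Z" for n by (intro z y) simp
    ultimately show ?thesis unfolding closure_sequential scaleR_zero_left by (intro exI conjI allI)
  qed
  then show "0 \<le> c \<Longrightarrow> x \<in> closure Z \<Longrightarrow> c *\<^sub>R x \<in> closure Z" using sc by (cases "c = 0") auto
  show "x \<in> closure Z \<Longrightarrow> y \<in> closure Z \<Longrightarrow> x + y \<in> closure Z" for x y
    using sc[of 2, OF _ convexD[OF conv, of x y "1/2" "1/2"]] by (simp add: scaleR_add_right)
  show "M *v x \<in> closure Z" if M: "M \<in> P" and x: "x \<in> closure Z"
  proof -
    have "(*v) M ` closure Z \<subseteq> closure Z"
      using M by (intro image_closure_subset closed_closure continuous_on_subset[OF matrix_vector_mult_linear_continuous_on])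
        (auto intro!: sub z)
    then show ?thesis using x by auto
  qed
qed

text \<open>The map t = 1 + a commutes with P and sends Z into Z, so by minimality t Z is dense in
  Z. A point of \<open>closure Z\<close> is then a limit of values t x_n, and the x_n have a
  convergent subsequence whose limit is the preimage.\<close>

lemma displacement_sum_surjective:
  assumes Z: "minimal_subcone P Z" and P: "P \<subseteq> Aut_Q"
    and comm: "\<And>M N. M \<in> P \<Longrightarrow> N \<in> P \<Longrightarrow> M ** N = N ** M"
    and a: "a \<in> P" and v: "v \<in> closure Z"
  obtains u where "u \<in> closure Z" "v = u + a *v u"
proof -
  have iZ: "invariant_subcone P Z" using Z by (simp add: minimal_subcone_def)
  note cl = closure_subcone[OF iZ]
  have ZQ: "Z \<subseteq> Q" and Zne: "Z \<noteq> {}" using iZ by (auto simp: invariant_subcone_def)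
  have subZ: "x \<in> Z \<Longrightarrow> x \<in> closure Z" for x using closure_subset by auto
  define t where "t x = x + a *v x" for x
  have lin: "linear t"
    unfolding t_def by (intro linear_compose_add linear_id[unfolded id_def] matrix_vector_mul_linear)
  have cont: "continuous_on S t" for S
    using lin linear_continuous_on linear_conv_bounded_linear by blast
  have tZ: "t x \<in> Z" if "x \<in> Z" for x
  proof -
    have "a *v x \<in> Z" using iZ a that by (auto simp: invariant_subcone_def)
    then have "t x \<in> Q" "t x \<in> closure Z" unfolding t_def using that ZQ cl(5) subZ by (auto intro: add_Q)
    then show ?thesis using cl(2) by blast
  qed
  have tZc: "t ` Z \<subseteq> closure (t ` Z)" by (rule closure_subset)
  obtain z where z: "z \<in> Z" using Zne by blast
  \<comment> \<open>The image t Z is not known to be closed in Q, so its relative closure is the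
    competitor to Z.\<close>
  have "invariant_subcone P (Q \<inter> closure (t ` Z))"
  proof (rule invariant_subconeI)
    show "t z \<in> Q" "t z \<in> closure (t ` Z)" using tZ[OF z] ZQ tZc z by auto
    show "closed (closure (t ` Z))" by simp
    show "convex (closure (t ` Z))"
      using iZ by (intro convex_closure convex_linear_image lin) (auto simp: invariant_subcone_def)
    show "c *\<^sub>R x \<in> closure (t ` Z)" if "0 < c" "x \<in> closure (t ` Z)" for c x
    proof -
      have "(\<lambda>x. c *\<^sub>R x) ` closure (t ` Z) \<subseteq> closure (t ` Z)"
      proof (intro image_closure_subset continuous_intros closed_closure)
        show "(\<lambda>x. c *\<^sub>R x) ` t ` Z \<subseteq> closure (t ` Z)"
        proof clarify
          fix x assume "x \<in> Z"
          then have "c *\<^sub>R x \<in> Z" using that iZ by (auto simp: invariant_subcone_def)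
          then have "t (c *\<^sub>R x) \<in> closure (t ` Z)" using tZc by blast
          then show "c *\<^sub>R t x \<in> closure (t ` Z)" by (simp add: linear_scale[OF lin])
        qed
      qed
      then show ?thesis using that by auto
    qed
    show "M *v x \<in> closure (t ` Z)" if "M \<in> P" "x \<in> closure (t ` Z)" for M x
    proof -
      have "(*v) M ` closure (t ` Z) \<subseteq> closure (t ` Z)"
      proof (intro image_closure_subset closed_closure continuous_on_subset[OF matrix_vector_mult_linear_continuous_on])
        show "(*v) M ` t ` Z \<subseteq> closure (t ` Z)"
        proof clarify
          fix x assume "x \<in> Z"
          then have "M *v x \<in> Z" using that iZ by (auto simp: invariant_subcone_def)
          then have "t (M *v x) \<in> closure (t ` Z)" using tZc by blast
          moreover have "t (M *v x) = M *v t x"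
            unfolding t_def using comm[OF \<open>M \<in> P\<close> a]
            by (simp add: matrix_vector_right_distrib matrix_vector_mul_assoc)
          ultimately show "M *v t x \<in> closure (t ` Z)" by simp
        qed
      qed (rule subset_UNIV)
      then show ?thesis using that by auto
    qed
  qed (rule P)
  moreover have "Q \<inter> closure (t ` Z) \<subseteq> Z"
    using closure_mono[of "t ` Z" Z] tZ cl(2) by blast
  ultimately have "Q \<inter> closure (t ` Z) = Z" using Z by (auto simp: minimal_subcone_def)
  then have "closure Z \<subseteq> closure (t ` Z)" by (intro closure_minimal) auto
  then have "v \<in> closure (t ` Z)" using v by blast
  then obtain s where s: "\<And>n. s n \<in> t ` Z" "s \<longlonglongrightarrow> v" unfolding closure_sequential by blast
  then have "\<forall>n. \<exists>x. x \<in> Z \<and> s n = t x" by blast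
  then obtain x where x: "\<And>n. x n \<in> Z" "\<And>n. s n = t (x n)" by metis
  have "bounded (range s)" using s(2) by (simp add: convergent_imp_bounded)
  then obtain R where R: "\<And>n. norm (s n) \<le> R" unfolding bounded_iff by blast
  \<comment> \<open>Since w is positive on a x_n, it is smaller on x_n than on s_n: preimages of a
    bounded sequence stay bounded.\<close>
  have "norm (x n) \<le> \<kappa> * (norm w * R)" for n
  proof -
    have xQ: "x n \<in> Q" using x ZQ by blast
    have "0 < w \<bullet> (a *v x n)" using a P xQ Aut_QD pos_Q by blast
    have "norm (x n) \<le> \<kappa> * (w \<bullet> x n)" using xQ by (rule bound_Q)
    also have "\<dots> \<le> \<kappa> * (w \<bullet> s n)"
      using kappa_pos \<open>0 < w \<bullet> (a *v x n)\<close> by (simp add: x(2) t_def inner_add_right)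
    also have "\<dots> \<le> \<kappa> * (norm w * norm (s n))"
      using kappa_pos Cauchy_Schwarz_ineq2[of w "s n"] by (intro mult_left_mono) auto
    also have "\<dots> \<le> \<kappa> * (norm w * R)" using kappa_pos R by (intro mult_left_mono) auto
    finally show ?thesis .
  qed
  then have "bounded (range x)" by (intro boundedI) auto
  then obtain u r where r: "strict_mono (r :: nat \<Rightarrow> nat)" "(x \<circ> r) \<longlonglongrightarrow> u"
    using bounded_imp_convergent_subsequence by blast
  have "u \<in> closure Z"
    unfolding closure_sequential using r(2) x(1) by (intro exI[of _ "x \<circ> r"]) simp
  moreover have "isCont t u" using cont[of UNIV] continuous_on_eq_continuous_at open_UNIV by blast
  then have "(t \<circ> (x \<circ> r)) \<longlonglongrightarrow> t u"
    using isCont_tendsto_compose[OF _ r(2)] by (simp add: o_def)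
  moreover have "t \<circ> (x \<circ> r) = s \<circ> r" using x by (auto simp: o_def)
  ultimately show thesis
    using that[of u] LIMSEQ_subseq_LIMSEQ[OF s(2) r(1)] LIMSEQ_unique unfolding t_def by metis
qed

text \<open>Since \<open>1 + a\<close> maps the closed cone onto itself, \<open>e = u + a u\<close> for some \<open>u\<close> in it, and
  extremality forces \<open>u\<close> and \<open>a u\<close> to be multiples of \<open>e\<close>.\<close>
lemma extreme_point_eigenvector:
  assumes Z: "minimal_subcone P Z" and P: "P \<subseteq> Aut_Q"
    and comm: "\<And>M N. M \<in> P \<Longrightarrow> N \<in> P \<Longrightarrow> M ** N = N ** M"
    and a: "a \<in> P" and e: "e extreme_point_of {v \<in> closure Z. w \<bullet> v = 1}"
  obtains c where "0 < c" "a *v e = c *\<^sub>R e"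
proof -
  have iZ: "invariant_subcone P Z" using Z by (simp add: minimal_subcone_def)
  note cl = closure_subcone[OF iZ]
  have eZ: "e \<in> closure Z" "w \<bullet> e = 1" using e by (auto simp: extreme_point_of_def)
  obtain u where u: "u \<in> closure Z" "e = u + a *v u"
    using displacement_sum_surjective[OF Z P comm a eZ(1)] by blast
  have inv: "invertible a" using a P by (auto simp: Aut_Q_def)
  have au: "a *v u \<in> closure Z" using cl(6) a u by blast
  have "u \<noteq> 0" using u eZ by auto
  moreover have "a *v u \<noteq> 0" using inv \<open>u \<noteq> 0\<close> by (metis matrix_inv_mult(4) matrix_vector_mult_0_right)
  ultimately have p: "0 < w \<bullet> u" "0 < w \<bullet> (a *v u)" using cl(1) u au closure_pos by blast+
  \<comment> \<open>These are the weights with which e = u + a u is a convex combination of u and a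
    u, each normalized to height 1; the eigenvalue will be \<beta> / \<alpha>.\<close>
  define \<alpha> \<beta> where "\<alpha> = w \<bullet> u" and "\<beta> = w \<bullet> (a *v u)"
  have sum1: "\<alpha> + \<beta> = 1" using eZ u by (simp add: \<alpha>_def \<beta>_def inner_add_right[symmetric])
  define x y where "x = (1/\<alpha>) *\<^sub>R u" and "y = (1/\<beta>) *\<^sub>R (a *v u)"
  have xy: "x \<in> {v \<in> closure Z. w \<bullet> v = 1}" "y \<in> {v \<in> closure Z. w \<bullet> v = 1}"
    using p cl(4) u au by (auto simp: x_def y_def \<alpha>_def \<beta>_def)
  have ab: "0 < \<alpha>" "0 < \<beta>" using p by (auto simp: \<alpha>_def \<beta>_def)
  have exy: "e = (1 - \<beta>) *\<^sub>R x + \<beta> *\<^sub>R y"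
  proof -
    have "1 - \<beta> = \<alpha>" using sum1 by simp
    then show ?thesis using ab u(2) by (simp add: x_def y_def)
  qed
  have "x = e \<and> y = e"
  proof (rule ccontr)
    assume neg: "\<not> (x = e \<and> y = e)"
    have "x \<noteq> y"
    proof
      assume "x = y"
      then have "e = x" using exy by (simp add: scaleR_left_distrib[symmetric])
      then show False using neg \<open>x = y\<close> by simp
    qed
    then have "e \<in> open_segment x y"
      unfolding in_segment using exy ab sum1 by (intro conjI exI[of _ \<beta>]) auto
    then show False using e xy unfolding extreme_point_of_def by blast
  qed
  moreover have "u = \<alpha> *\<^sub>R x" "a *v u = \<beta> *\<^sub>R y" using ab by (auto simp: x_def y_def)
  ultimately have xe: "u = \<alpha> *\<^sub>R e" "a *v u = \<beta> *\<^sub>R e" by auto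
  then have "\<alpha> *\<^sub>R (a *v e) = \<beta> *\<^sub>R e" by (metis matrix_vector_mult_scaleR)
  then have "(1/\<alpha>) *\<^sub>R (\<alpha> *\<^sub>R (a *v e)) = (1/\<alpha>) *\<^sub>R (\<beta> *\<^sub>R e)" by simp
  then have "a *v e = (\<beta> / \<alpha>) *\<^sub>R e" using ab by simp
  then show thesis using that[of "\<beta> / \<alpha>"] ab by simp
qed

text \<open>The compact slice of \<open>closure Z\<close> is the hull of its extreme points, but
  only a basis E of their span is kept. The part in Q of the cone over E is already a nonempty
  invariant subcone of Z, so it equals Z, and no facet of it meets Z, as that facet would cut out a
  smaller invariant subcone.\<close>

lemma minimal_subcone_simplicial:
  assumes Z: "minimal_subcone P Z" and P: "P \<subseteq> Aut_Q"
    and comm: "\<And>M N. M \<in> P \<Longrightarrow> N \<in> P \<Longrightarrow> M ** N = N ** M"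
  obtains M :: "real^'n^'n" and I where "invertible M" "I \<noteq> {}" "Z = (*v) M ` open_orthant I"
    "\<And>a i. a \<in> P \<Longrightarrow> i \<in> I \<Longrightarrow> \<exists>c>0. a *v (M *v axis i 1) = c *\<^sub>R (M *v axis i 1)"
proof -
  have iZ: "invariant_subcone P Z" using Z by (simp add: minimal_subcone_def)
  have minZ: "Z' = Z" if "invariant_subcone P Z'" "Z' \<subseteq> Z" for Z'
    using Z that by (simp add: minimal_subcone_def)
  note cl = closure_subcone[OF iZ]
  have ZQ: "Z \<subseteq> Q" and Zne: "Z \<noteq> {}"
    using iZ by (auto simp: invariant_subcone_def)
  define B where "B = {v \<in> closure Z. w \<bullet> v = 1}"
  have Beq: "B = closure Z \<inter> {v. w \<bullet> v = 1}" by (auto simp: B_def)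
  have "bounded B"
    using cl(1) closure_bound by (intro boundedI[of _ \<kappa>]) (fastforce simp: B_def)
  then have "compact B" unfolding compact_eq_bounded_closed Beq
    by (auto intro!: closed_Int closed_hyperplane)
  moreover have "convex B" unfolding Beq by (intro convex_Int cl(3) convex_hyperplane)
  ultimately have KM: "B = convex hull {x. x extreme_point_of B}" by (rule Krein_Milman_Minkowski)
  define X where "X = {x. x extreme_point_of B}"
  obtain E where E: "E \<subseteq> X" "independent E" "X \<subseteq> span E"
    using maximal_independent_subset by blast
  obtain M :: "real^'n^'n" and I where M: "invertible M" "E = (\<lambda>i. M *v axis i 1) ` I"
    using matrix_with_columns[OF E(2)] by blast
  define N where "N = matrix_inv M"
  have MN: "M *v (N *v v) = v" "N *v (M *v v) = v" for v using M(1) by (auto simp: N_def)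
  define h where "h i = M *v axis i 1" for i
  have Mh: "M *v x = (\<Sum>i\<in>UNIV. (x $ i) *\<^sub>R h i)" for x
    unfolding h_def by (rule matrix_vector_sum_axis)
  have MhI: "M *v x = (\<Sum>i\<in>I. (x $ i) *\<^sub>R h i)" if "\<forall>i. i \<notin> I \<longrightarrow> x $ i = 0" for x
    unfolding Mh using that by (intro sum.mono_neutral_right) auto
  have Nh: "N *v h i = axis i 1" for i by (simp add: h_def MN)
  have hX: "h i extreme_point_of B" if "i \<in> I" for i using that M(2) E(1) unfolding X_def h_def by blast
  have hZ: "h i \<in> closure Z" if "i \<in> I" for i using hX[OF that] by (auto simp: extreme_point_of_def B_def)
  have hQ: "h i \<in> closure Q" if "i \<in> I" for i using hZ[OF that] cl(1) by blast
  have eig: "\<exists>c>0. a *v h i = c *\<^sub>R h i" if "a \<in> P" "i \<in> I" for a i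
    using extreme_point_eigenvector[OF Z P comm that(1) hX[OF that(2), unfolded B_def]] by blast
  have sumZ: "(\<Sum>i\<in>I. c i *\<^sub>R h i) \<in> closure Z" if "\<And>i. i \<in> I \<Longrightarrow> 0 \<le> c i" for c
  proof -
    have 0: "0 \<in> closure Z" using Zne cl(4)[of 0] closure_subset by auto
    have "finite J \<Longrightarrow> J \<subseteq> I \<Longrightarrow> (\<Sum>i\<in>J. c i *\<^sub>R h i) \<in> closure Z" for J
      by (induction J rule: finite_induct) (auto simp: 0 intro!: cl(5) cl(4) that hZ)
    then show ?thesis by (simp add: finite_subset)
  qed
  have coordZ: "(N *v z) $ j = 0" if "z \<in> Z" "j \<notin> I" for z j
  proof -
    have zw: "0 < w \<bullet> z" using that ZQ pos_Q by blast
    have "(1 / (w \<bullet> z)) *\<^sub>R z \<in> B" using zw that closure_subset[of Z] cl(4) by (auto simp: B_def)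
    then have "(1 / (w \<bullet> z)) *\<^sub>R z \<in> span X"
      using KM convex_hull_subset_span unfolding X_def by blast
    then have "(1 / (w \<bullet> z)) *\<^sub>R z \<in> span E" using E(3) span_mono span_span by blast
    then have "(w \<bullet> z) *\<^sub>R ((1 / (w \<bullet> z)) *\<^sub>R z) \<in> span E" by (rule span_scale)
    then have "z \<in> span E" using zw by simp
    moreover have "span E \<subseteq> {v. (N *v v) $ j = 0}"
    proof (rule span_minimal)
      show "E \<subseteq> {v. (N *v v) $ j = 0}" using M(2) that Nh by (auto simp: axis_def h_def)
      show "subspace {v. (N *v v) $ j = 0}"
        by (auto simp: subspace_def matrix_vector_right_distrib matrix_vector_mult_scaleR)
    qed
    ultimately show ?thesis by blast
  qed
  \<comment> \<open>Strictly positive combinations of the chosen rays lie in Q and not only in its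
    closure: a large multiple exceeds a given z in Z coordinatewise, and z plus a point of
    \<open>closure Q\<close> lies in Q.\<close>
  have posZ: "M *v x \<in> Z" if x: "x \<in> open_orthant I" for x
  proof -
    have x0: "\<forall>i. i \<notin> I \<longrightarrow> x $ i = 0" and xp: "\<And>i. i \<in> I \<Longrightarrow> 0 < x $ i"
      using x by (auto simp: open_orthant_def)
    obtain z where z: "z \<in> Z" using Zne by blast
    define q where "q = N *v z"
    have zq: "z = M *v q" by (simp add: q_def MN)
    have q0: "\<forall>i. i \<notin> I \<longrightarrow> q $ i = 0" using coordZ z by (simp add: q_def)
    \<comment> \<open>The sum dominates every ratio q_i / x_i and the summand 1 keeps t
      positive.\<close>
    define t where "t = 1 + (\<Sum>i\<in>I. \<bar>q $ i\<bar> / x $ i)"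
    have t: "q $ i \<le> t * x $ i" if "i \<in> I" for i
    proof -
      have "\<bar>q $ i\<bar> / x $ i \<le> (\<Sum>i\<in>I. \<bar>q $ i\<bar> / x $ i)"
        using that xp by (intro member_le_sum) (auto intro!: divide_nonneg_pos)
      then have "\<bar>q $ i\<bar> / x $ i \<le> t" by (simp add: t_def)
      then show ?thesis using xp[OF that] by (simp add: field_simps)
    qed
    have tp: "0 < t" unfolding t_def using xp
      by (intro add_pos_nonneg sum_nonneg divide_nonneg_pos) auto
    have "t *\<^sub>R (M *v x) = z + (\<Sum>i\<in>I. (t * x $ i - q $ i) *\<^sub>R h i)"
      unfolding zq MhI[OF x0] MhI[OF q0]
      by (simp add: scaleR_sum_right scaleR_left_diff_distrib sum_subtractf)
    moreover have "(\<Sum>i\<in>I. (t * x $ i - q $ i) *\<^sub>R h i) \<in> closure Q"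
      using t hQ by (intro closure_sum closure_scale) auto
    ultimately have "t *\<^sub>R (M *v x) \<in> Q" using add_closure z ZQ by auto
    then have "M *v x \<in> Q" using scale_Q[of "1/t"] tp by fastforce
    moreover have "M *v x \<in> closure Z" unfolding MhI[OF x0] using xp by (intro sumZ) (auto intro: less_imp_le)
    ultimately show ?thesis using cl(2) by blast
  qed
  define u :: "real^'n" where "u = (\<chi> i. if i \<in> I then 1 else 0)"
  have u: "u \<in> open_orthant I" by (auto simp: u_def open_orthant_def)
  have cont: "continuous_on UNIV (\<lambda>v. (N *v v) $ j)" for j
    by (intro continuous_intros matrix_vector_mult_linear_continuous_on)
  have coord: "(N *v (a *v v)) $ i = (if i \<in> I then (N *v v) $ i * ev i else 0)"
    if v: "\<forall>j. j \<notin> I \<longrightarrow> (N *v v) $ j = 0" and ev: "\<And>i. i \<in> I \<Longrightarrow> a *v h i = ev i *\<^sub>R h i" for a v i ev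
  proof -
    have "v = (\<Sum>j\<in>I. (N *v v) $ j *\<^sub>R h j)" using MhI[OF v] MN(1)[of v] by simp
    then have "a *v v = a *v (\<Sum>j\<in>I. (N *v v) $ j *\<^sub>R h j)" by simp
    also have "\<dots> = (\<Sum>j\<in>I. ((N *v v) $ j * ev j) *\<^sub>R h j)"
      using ev by (simp add: linear_sum[OF matrix_vector_mul_linear] matrix_vector_mult_scaleR)
    finally have "N *v (a *v v) = (\<Sum>j\<in>I. ((N *v v) $ j * ev j) *\<^sub>R axis j 1)"
      by (simp add: linear_sum[OF matrix_vector_mul_linear] matrix_vector_mult_scaleR Nh)
    then have "(N *v (a *v v)) $ i = (\<Sum>j\<in>I. ((N *v v) $ j * ev j) * axis j 1 $ i)"
      by (simp only: sum_component vector_scaleR_component real_scaleR_def)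
    also have "\<dots> = (\<Sum>j\<in>I. if j = i then (N *v v) $ j * ev j else 0)"
      by (intro sum.cong refl) (simp add: axis_def)
    finally show ?thesis by simp
  qed
  \<comment> \<open>The face of the simplicial cone on which the coordinates in F vanish. It is
    invariant because P acts diagonally; F = {} gives the whole cone and F = {j} a facet.\<close>
  define D where "D F = {v. (\<forall>j. j \<notin> I \<longrightarrow> (N *v v) $ j = 0) \<and> (\<forall>j\<in>I. 0 \<le> (N *v v) $ j) \<and> (\<forall>j\<in>F. (N *v v) $ j = 0)}" for F
  have D: "Q \<inter> D F = Z" if F: "F \<subseteq> I" and x: "x \<in> Q" "x \<in> D F" for F x
  proof (rule minZ)
    show "invariant_subcone P (Q \<inter> D F)"
    proof (rule invariant_subconeI[OF x])
      have "D F = (\<Inter>j\<in>-I. {v. (N *v v) $ j = 0}) \<inter> (\<Inter>j\<in>I. {v. 0 \<le> (N *v v) $ j}) \<inter> (\<Inter>j\<in>F. {v. (N *v v) $ j = 0})"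
        by (auto simp: D_def)
      moreover have "closed {v. (N *v v) $ j = 0}" "closed {v. 0 \<le> (N *v v) $ j}" for j
        by (intro closed_Collect_eq closed_Collect_le cont continuous_on_const)+
      ultimately show "closed (D F)" by (auto intro!: closed_Int closed_INT)
      show "convex (D F)"
        by (auto simp: convex_def D_def matrix_vector_right_distrib matrix_vector_mult_scaleR)
      show "c *\<^sub>R x \<in> D F" if "0 < c" "x \<in> D F" for c x
        using that by (auto simp: D_def matrix_vector_mult_scaleR)
      show "a *v x \<in> D F" if a: "a \<in> P" and x: "x \<in> D F" for a x
      proof -
        have v: "\<forall>j. j \<notin> I \<longrightarrow> (N *v x) $ j = 0" using x by (auto simp: D_def)
        obtain ev where ev: "\<And>i. i \<in> I \<Longrightarrow> 0 < ev i \<and> a *v h i = ev i *\<^sub>R h i"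
          using eig[OF a] by metis
        then have "(N *v (a *v x)) $ j = (if j \<in> I then (N *v x) $ j * ev j else 0)" for j
          using coord[OF v, of a ev] by blast
        then show ?thesis using x ev F by (auto simp: D_def less_imp_le)
      qed
    qed (rule P)
    show "Q \<inter> D F \<subseteq> Z"
    proof
      fix v assume v: "v \<in> Q \<inter> D F"
      then have "v = (\<Sum>i\<in>I. (N *v v) $ i *\<^sub>R h i)"
        using MhI[of "N *v v"] MN(1)[of v] by (simp add: D_def)
      then have "v \<in> closure Z" using v sumZ[of "\<lambda>i. (N *v v) $ i"] by (simp add: D_def)
      then show "v \<in> Z" using v cl(2) by blast
    qed
  qed
  have uZ: "M *v u \<in> Z" by (rule posZ[OF u])
  have Nu: "N *v (M *v u) = u" by (rule MN)
  have "M *v u \<in> D {}" by (simp add: D_def Nu) (simp add: u_def)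
  then have ZD: "Q \<inter> D {} = Z" using D[of "{}" "M *v u"] uZ ZQ by blast
  have "Z = (*v) M ` open_orthant I"
  proof
    show "(*v) M ` open_orthant I \<subseteq> Z" using posZ by blast
    show "Z \<subseteq> (*v) M ` open_orthant I"
    proof
      fix z assume z: "z \<in> Z"
      then have zD: "z \<in> D {}" using ZD by blast
      \<comment> \<open>A vanishing coordinate of z would force all of Z into the facet D {j}, but
        the coordinates of M u on I are all 1.\<close>
      have "0 < (N *v z) $ j" if j: "j \<in> I" for j
      proof (rule ccontr)
        assume "\<not> 0 < (N *v z) $ j"
        then have "z \<in> D {j}" using zD j by (auto simp: D_def intro: antisym)
        then have "Q \<inter> D {j} = Z" using D[of "{j}" z] j z ZQ by blast
        then have "M *v u \<in> D {j}" using uZ by blast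
        then show False using j by (simp add: D_def Nu) (simp add: u_def)
      qed
      then have "N *v z \<in> open_orthant I" using zD by (auto simp: open_orthant_def D_def)
      then show "z \<in> (*v) M ` open_orthant I" using MN(1)[of z] by (metis imageI)
    qed
  qed
  moreover have "I \<noteq> {}"
  proof
    assume "I = {}"
    then have "M *v u = 0" using MhI[of u] by (simp add: u_def)
    then show False using uZ ZQ pos_Q by fastforce
  qed
  ultimately show thesis using that[of M I] M(1) eig unfolding h_def by blast
qed

end

section \<open>Projective classes and lifts\<close>

lemma mem_proj_class: "v \<in> proj_class v"
  unfolding proj_class_def by (intro CollectI exI[of _ 1]) simp

lemma proj_class_scale: "c \<noteq> 0 \<Longrightarrow> proj_class (c *\<^sub>R v) = proj_class v"
proof -
  assume c: "c \<noteq> 0"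
  have "\<exists>d. d *\<^sub>R v = e *\<^sub>R c *\<^sub>R v \<and> d \<noteq> 0" if "e \<noteq> 0" for e
    using c that by (intro exI[of _ "e * c"]) simp
  moreover have "\<exists>d. e *\<^sub>R v = d *\<^sub>R c *\<^sub>R v \<and> d \<noteq> 0" if "e \<noteq> 0" for e
    using c that by (intro exI[of _ "e / c"]) simp
  ultimately show ?thesis unfolding proj_class_def by (auto; metis)
qed

lemma proj_class_eqD:
  assumes "proj_class u = proj_class v"
  obtains c where "c \<noteq> 0" "u = c *\<^sub>R v"
  using mem_proj_class[of u] assms unfolding proj_class_def by blast

lemma proj_class_minus: "proj_class (- v) = proj_class v"
  using proj_class_scale[of "-1" v] by simp

lemma proj_class_in_space: "v \<noteq> 0 \<Longrightarrow> proj_class v \<in> proj_space"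
  by (auto simp: proj_space_def)

lemma openin_proj_top:
  "openin proj_top U \<longleftrightarrow> U \<subseteq> proj_space \<and> open {v::'a::real_normed_vector. v \<noteq> 0 \<and> proj_class v \<in> U}"
proof -
  have "istopology (\<lambda>U. U \<subseteq> proj_space \<and> open {v::'a. v \<noteq> 0 \<and> proj_class v \<in> U})"
    unfolding istopology_def
  proof (rule conjI; clarify)
    fix S T assume *: "S \<subseteq> proj_space" "open {v::'a. v \<noteq> 0 \<and> proj_class v \<in> S}"
      "open {v::'a. v \<noteq> 0 \<and> proj_class v \<in> T}"
    have "{v::'a. v \<noteq> 0 \<and> proj_class v \<in> S \<inter> T} =
      {v::'a. v \<noteq> 0 \<and> proj_class v \<in> S} \<inter> {v::'a. v \<noteq> 0 \<and> proj_class v \<in> T}" by auto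
    then show "S \<inter> T \<subseteq> proj_space \<and> open {v::'a. v \<noteq> 0 \<and> proj_class v \<in> S \<inter> T}"
      using * by auto
  next
    fix \<K> assume *: "\<forall>K\<in>\<K>. K \<subseteq> proj_space \<and> open {v::'a. v \<noteq> 0 \<and> proj_class v \<in> K}"
    have "{v::'a. v \<noteq> 0 \<and> proj_class v \<in> \<Union>\<K>} = (\<Union>K\<in>\<K>. {v::'a. v \<noteq> 0 \<and> proj_class v \<in> K})" by auto
    then show "\<Union>\<K> \<subseteq> proj_space \<and> open {v::'a. v \<noteq> 0 \<and> proj_class v \<in> \<Union>\<K>}"
      using * by auto
  qed
  then show ?thesis unfolding proj_top_def by (simp add: topology_inverse')
qed

lemma topspace_proj_top: "topspace (proj_top :: 'a::real_normed_vector set topology) = proj_space"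
proof
  show "topspace proj_top \<subseteq> (proj_space :: 'a set set)"
    using openin_topspace[of "proj_top :: 'a set topology"] unfolding openin_proj_top by blast
  have "{v::'a. v \<noteq> 0 \<and> proj_class v \<in> proj_space} = - {0}" by (auto simp: proj_class_in_space)
  then have "openin proj_top (proj_space :: 'a set set)"
    unfolding openin_proj_top by (simp add: open_Compl)
  then show "(proj_space :: 'a set set) \<subseteq> topspace proj_top" by (rule openin_subset)
qed

lemma compactin_proj_class:
  fixes K :: "'a::real_normed_vector set"
  assumes "compact K" "0 \<notin> K"
  shows "compactin proj_top (proj_class ` K)"
proof (rule image_compactin[where X = "top_of_set (- {0})"])
  show "compactin (top_of_set (- {0})) K" using assms by (auto simp: compactin_subtopology)
  show "continuous_map (top_of_set (- {0})) proj_top (proj_class :: 'a \<Rightarrow> 'a set)"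
    unfolding continuous_map topspace_proj_top
  proof (intro conjI allI impI)
    show "proj_class ` topspace (top_of_set (- {0::'a})) \<subseteq> proj_space" by (auto intro: proj_class_in_space)
    fix U :: "'a set set" assume "openin proj_top U"
    then have "open {v. v \<noteq> 0 \<and> proj_class v \<in> U}" by (simp add: openin_proj_top)
    moreover have "{x \<in> topspace (top_of_set (- {0})). proj_class x \<in> U} =
      - {0} \<inter> {v. v \<noteq> 0 \<and> proj_class v \<in> U}" by auto
    ultimately show "openin (top_of_set (- {0})) {x \<in> topspace (top_of_set (- {0})). proj_class x \<in> U}"
      by (auto simp: openin_open)
  qed
qed

lemma scaleR_matrix_mult: "(c *\<^sub>R M) ** (d *\<^sub>R N) = (c * d) *\<^sub>R (M ** N)" for M N :: "real^'n^'n"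
  by (simp add: vec_eq_iff matrix_matrix_mult_def sum_distrib_left mult_ac)

lemma scaleR_matrix_vector: "(c *\<^sub>R M) *v (d *\<^sub>R v) = (c * d) *\<^sub>R (M *v v)" for M :: "real^'n^'n"
  by (simp add: vec_eq_iff matrix_vector_mult_def sum_distrib_left mult_ac)

lemma scaleR_matrix_vector': "(c *\<^sub>R M) *v v = c *\<^sub>R (M *v v)" for M :: "real^'n^'n"
  using scaleR_matrix_vector[of c M 1 v] by simp

lemma pgl_act_proj_class: "pgl_act (proj_class M) (proj_class v) = proj_class (M *v v)"
proof -
  have "\<exists>c. x = c *\<^sub>R (M *v v) \<and> c \<noteq> 0" if x: "x \<in> pgl_act (proj_class M) (proj_class v)" for x
  proof -
    obtain c d where "x = (c *\<^sub>R M) *v (d *\<^sub>R v)" "c \<noteq> 0" "d \<noteq> 0"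
      using x unfolding pgl_act_def proj_class_def by blast
    then show ?thesis by (intro exI[of _ "c * d"]) (simp add: scaleR_matrix_vector)
  qed
  moreover have "c *\<^sub>R (M *v v) \<in> pgl_act (proj_class M) (proj_class v)" if "c \<noteq> 0" for c
    using that mem_proj_class[of v] unfolding pgl_act_def proj_class_def
    by (intro CollectI exI[of _ "c *\<^sub>R M"] exI[of _ v]) (auto simp: scaleR_matrix_vector')
  ultimately show ?thesis unfolding proj_class_def[of "M *v v"] by blast
qed

lemma pgl_mult: "proj_class M \<otimes>\<^bsub>pgl_group\<^esub> proj_class N = proj_class (M ** N)"
proof -
  have "\<exists>c. x = c *\<^sub>R (M ** N) \<and> c \<noteq> 0" if x: "x \<in> proj_class M \<otimes>\<^bsub>pgl_group\<^esub> proj_class N" for x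
  proof -
    obtain c d where "x = (c *\<^sub>R M) ** (d *\<^sub>R N)" "c \<noteq> 0" "d \<noteq> 0"
      using x unfolding pgl_group_def proj_class_def by auto
    then show ?thesis by (intro exI[of _ "c * d"]) (simp add: scaleR_matrix_mult)
  qed
  moreover have "c *\<^sub>R (M ** N) \<in> proj_class M \<otimes>\<^bsub>pgl_group\<^esub> proj_class N" if "c \<noteq> 0" for c
  proof -
    have "c *\<^sub>R M \<in> proj_class M" using that by (auto simp: proj_class_def)
    moreover have "c *\<^sub>R (M ** N) = (c *\<^sub>R M) ** N" using scaleR_matrix_mult[of c M 1 N] by simp
    ultimately show ?thesis using mem_proj_class[of N] unfolding pgl_group_def by auto
  qed
  ultimately show ?thesis unfolding proj_class_def[of "M ** N"] by blast
qed

lemma pgl_carrier: "carrier pgl_group = {proj_class M | M :: real^'n^'n. invertible M}"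
  by (simp add: pgl_group_def pgl_def)

lemma pgl_one: "\<one>\<^bsub>pgl_group\<^esub> = proj_class (mat 1)"
  by (simp add: pgl_group_def)

lemma invertible_mat_1: "invertible (mat 1 :: real^'n^'n)"
  unfolding invertible_def by (intro exI[of _ "mat 1"]) simp

lemma group_pgl: "group (pgl_group :: (real^'n^'n) set monoid)"
proof (rule groupI)
  show "\<one>\<^bsub>pgl_group\<^esub> \<in> carrier (pgl_group :: (real^'n^'n) set monoid)"
    unfolding pgl_carrier pgl_one using invertible_mat_1 by blast
next
  fix x y :: "(real^'n^'n) set" assume "x \<in> carrier pgl_group" "y \<in> carrier pgl_group"
  then show "x \<otimes>\<^bsub>pgl_group\<^esub> y \<in> carrier pgl_group"
    by (auto simp: pgl_carrier pgl_mult intro: invertible_mult)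
next
  fix x y z :: "(real^'n^'n) set"
  assume "x \<in> carrier pgl_group" "y \<in> carrier pgl_group" "z \<in> carrier pgl_group"
  then show "x \<otimes>\<^bsub>pgl_group\<^esub> y \<otimes>\<^bsub>pgl_group\<^esub> z = x \<otimes>\<^bsub>pgl_group\<^esub> (y \<otimes>\<^bsub>pgl_group\<^esub> z)"
    by (auto simp: pgl_carrier pgl_mult matrix_mul_assoc)
next
  fix x :: "(real^'n^'n) set" assume "x \<in> carrier pgl_group"
  then obtain M where M: "x = proj_class M" "invertible M" by (auto simp: pgl_carrier)
  then show "\<one>\<^bsub>pgl_group\<^esub> \<otimes>\<^bsub>pgl_group\<^esub> x = x" by (simp add: pgl_one pgl_mult)
  have "proj_class (matrix_inv M) \<otimes>\<^bsub>pgl_group\<^esub> x = \<one>\<^bsub>pgl_group\<^esub>"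
    using M by (simp add: pgl_one pgl_mult)
  moreover have "proj_class (matrix_inv M) \<in> carrier pgl_group"
    unfolding pgl_carrier using M matrix_inv_mult(5) by blast
  ultimately show "\<exists>y\<in>carrier pgl_group. y \<otimes>\<^bsub>pgl_group\<^esub> x = \<one>\<^bsub>pgl_group\<^esub>" by blast
qed

lemma pgl_inv: "invertible M \<Longrightarrow> inv\<^bsub>pgl_group\<^esub> (proj_class M) = proj_class (matrix_inv M)"
  for M :: "real^'n^'n"
proof -
  assume M: "invertible M"
  show ?thesis
  proof (rule group.inv_equality[OF group_pgl])
    show "proj_class (matrix_inv M) \<otimes>\<^bsub>pgl_group\<^esub> proj_class M = \<one>\<^bsub>pgl_group\<^esub>"
      using M by (simp add: pgl_one pgl_mult)
    show "proj_class M \<in> carrier pgl_group" "proj_class (matrix_inv M) \<in> carrier pgl_group"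
      unfolding pgl_carrier using M matrix_inv_mult(5) by blast+
  qed
qed

lemma subgroup_pgl_mult:
  "subgroup G pgl_group \<Longrightarrow> proj_class M \<in> G \<Longrightarrow> proj_class N \<in> G \<Longrightarrow> proj_class (M ** N) \<in> G"
  using subgroup.m_closed pgl_mult by metis

lemma subgroup_pgl_inv:
  "subgroup G pgl_group \<Longrightarrow> invertible M \<Longrightarrow> proj_class M \<in> G \<Longrightarrow> proj_class (matrix_inv M) \<in> G"
  using subgroup.m_inv_closed pgl_inv by metis

section \<open>The cone over a properly convex domain and the lifts of its automorphisms\<close>

locale projective_cone = sharp_cone Q w \<kappa> for Q :: "(real^'n) set" and w \<kappa> +
  fixes \<Omega> :: "(real^'n) set set"
  assumes Q_eq: "Q = {v. 0 < w \<bullet> v \<and> proj_class v \<in> \<Omega>}"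
    and \<Omega>_space: "\<Omega> \<subseteq> proj_space" and \<Omega>_chart: "\<And>v. proj_class v \<in> \<Omega> \<Longrightarrow> w \<bullet> v \<noteq> 0"

text \<open>Up to scale, u x + v y is a convex combination of the normalizations of x and y, with
  weights proportional to u (w x) and v (w y).\<close>

lemma convex_chart_cone:
  assumes cv: "convex (chart_lift w C)"
  shows "convex {v. 0 < w \<bullet> v \<and> proj_class v \<in> C}" (is "convex ?Q")
proof (rule convexI)
  fix x y and u v :: real
  assume xy: "x \<in> ?Q" "y \<in> ?Q" and uv: "0 \<le> u" "0 \<le> v" "u + v = 1"
  have chart: "(1 / (w \<bullet> v)) *\<^sub>R v \<in> chart_lift w C" if "v \<in> ?Q" for v
    using that by (auto simp: chart_lift_def proj_class_scale)
  let ?a = "u * (w \<bullet> x)" and ?b = "v * (w \<bullet> y)"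
  have p: "0 < w \<bullet> x" "0 < w \<bullet> y" using xy by auto
  then have s: "0 < ?a + ?b" using uv
    by (metis add_nonneg_pos add_pos_nonneg less_eq_real_def mult_nonneg_nonneg mult_pos_pos zero_neq_one add_0)
  have "(?a / (?a + ?b)) *\<^sub>R ((1 / (w \<bullet> x)) *\<^sub>R x) + (?b / (?a + ?b)) *\<^sub>R ((1 / (w \<bullet> y)) *\<^sub>R y) \<in> chart_lift w C"
    using s uv p by (intro convexD[OF cv chart chart] xy) (auto simp: add_divide_distrib[symmetric])
  then have "(1 / (?a + ?b)) *\<^sub>R (u *\<^sub>R x + v *\<^sub>R y) \<in> chart_lift w C"
    using p by (simp add: scaleR_add_right)
  then have "proj_class ((1 / (?a + ?b)) *\<^sub>R (u *\<^sub>R x + v *\<^sub>R y)) \<in> C" unfolding chart_lift_def by blast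
  moreover have "proj_class ((1 / (?a + ?b)) *\<^sub>R (u *\<^sub>R x + v *\<^sub>R y)) = proj_class (u *\<^sub>R x + v *\<^sub>R y)"
    using s by (intro proj_class_scale) simp
  ultimately have "proj_class (u *\<^sub>R x + v *\<^sub>R y) \<in> C" by (simp only:)
  then show "u *\<^sub>R x + v *\<^sub>R y \<in> ?Q" using s by (simp add: inner_add_right)
qed

lemma projective_cone_exists:
  fixes \<Omega> :: "(real^'n) set set"
  assumes ch: "in_chart_bounded_convex w \<Omega>" and op: "openin proj_top \<Omega>" and ne: "\<Omega> \<noteq> {}"
  obtains \<kappa> where "projective_cone {v. 0 < w \<bullet> v \<and> proj_class v \<in> \<Omega>} w \<kappa> \<Omega>"
proof -
  define Q where "Q = {v. 0 < w \<bullet> v \<and> proj_class v \<in> \<Omega>}"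
  have sp: "\<Omega> \<subseteq> proj_space" and nz: "\<And>p v. p \<in> \<Omega> \<Longrightarrow> v \<in> p \<Longrightarrow> w \<bullet> v \<noteq> 0"
    and bd: "bounded (chart_lift w \<Omega>)" and cv: "convex (chart_lift w \<Omega>)"
    using ch by (auto simp: in_chart_bounded_convex_def)
  \<comment> \<open>The norm bound at height 1 extends to all of Q by homogeneity.\<close>
  obtain \<kappa> where \<kappa>: "\<And>v. v \<in> chart_lift w \<Omega> \<Longrightarrow> norm v \<le> \<kappa>" using bd bounded_iff by blast
  have chart: "(1 / (w \<bullet> v)) *\<^sub>R v \<in> chart_lift w \<Omega>" if "v \<in> Q" for v
    using that by (auto simp: Q_def chart_lift_def proj_class_scale)
  have "sharp_cone Q w \<kappa>"
  proof
    have "Q = {v. 0 < w \<bullet> v} \<inter> {v. v \<noteq> 0 \<and> proj_class v \<in> \<Omega>}" by (auto simp: Q_def)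
    moreover have "open {v. v \<noteq> 0 \<and> proj_class v \<in> \<Omega>}" using op by (simp add: openin_proj_top)
    ultimately show "open Q" by (simp add: open_Int open_halfspace_gt)
    show "c *\<^sub>R x \<in> Q" if "0 < c" "x \<in> Q" for c x
      using that by (auto simp: Q_def proj_class_scale)
    show "convex Q" unfolding Q_def by (rule convex_chart_cone[OF cv])
    show pos: "0 < w \<bullet> x" if "x \<in> Q" for x using that by (simp add: Q_def)
    show "norm x \<le> \<kappa> * (w \<bullet> x)" if "x \<in> Q" for x
    proof -
      have "norm x / (w \<bullet> x) \<le> \<kappa>" using \<kappa>[OF chart[OF that]] pos[OF that] by simp
      then show ?thesis using pos[OF that] by (simp add: pos_divide_le_eq)
    qed
    obtain p where "p \<in> \<Omega>" using ne by blast
    then obtain v where v: "p = proj_class v" using sp by (auto simp: proj_space_def)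
    then have "w \<bullet> v \<noteq> 0" using nz[OF \<open>p \<in> \<Omega>\<close>] mem_proj_class by blast
    then have "v \<in> Q \<or> - v \<in> Q" using v \<open>p \<in> \<Omega>\<close> by (auto simp: Q_def proj_class_minus)
    then show "Q \<noteq> {}" by blast
  qed
  moreover have "w \<bullet> v \<noteq> 0" if "proj_class v \<in> \<Omega>" for v using nz[OF that] mem_proj_class by blast
  ultimately have "projective_cone Q w \<kappa> \<Omega>"
    unfolding projective_cone_def projective_cone_axioms_def using sp by (simp add: Q_def)
  then show thesis using that unfolding Q_def by blast
qed

context projective_cone begin

lemma proj_class_in_\<Omega>: "v \<in> Q \<Longrightarrow> proj_class v \<in> \<Omega>" by (simp add: Q_eq)

lemma \<Omega>_cases: "proj_class v \<in> \<Omega> \<Longrightarrow> v \<in> Q \<or> - v \<in> Q"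
  using \<Omega>_chart[of v] by (auto simp: Q_eq proj_class_minus)

lemma \<Omega>_rep: assumes "p \<in> \<Omega>" obtains v where "v \<in> Q" "p = proj_class v"
proof -
  obtain u where "p = proj_class u" using assms \<Omega>_space by (auto simp: proj_space_def)
  then show thesis using \<Omega>_cases[of u] that[of u] that[of "- u"] assms by (auto simp: proj_class_minus)
qed

lemma Q_proj_class_eq:
  assumes "u \<in> Q" "v \<in> Q" "proj_class u = proj_class v"
  obtains c where "0 < c" "u = c *\<^sub>R v"
proof -
  obtain c where c: "c \<noteq> 0" "u = c *\<^sub>R v" using assms(3) by (rule proj_class_eqD)
  then have "0 < c * (w \<bullet> v)" using pos_Q[OF assms(1)] by simp
  then have "0 < c" using pos_Q[OF assms(2)] by (simp add: zero_less_mult_iff)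
  then show thesis using c that by blast
qed

lemma Q_nonzero: "v \<in> Q \<Longrightarrow> v \<noteq> 0" using pos_Q by fastforce

lemma Aut_Q_scale: "M \<in> Aut_Q \<Longrightarrow> 0 < c \<Longrightarrow> c *\<^sub>R M \<in> Aut_Q"
proof -
  assume M: "M \<in> Aut_Q" and c: "0 < c"
  have "(c *\<^sub>R M) ** ((1/c) *\<^sub>R matrix_inv M) = mat 1"
    using M c by (simp add: scaleR_matrix_mult Aut_Q_def)
  then have "invertible (c *\<^sub>R M)" using invertible_right_inverse by blast
  moreover have "(*v) (c *\<^sub>R M) ` Q = Q"
  proof
    show "(*v) (c *\<^sub>R M) ` Q \<subseteq> Q" using M c by (auto simp: scaleR_matrix_vector' intro!: scale_Q Aut_QD)
    show "Q \<subseteq> (*v) (c *\<^sub>R M) ` Q"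
    proof
      fix x assume "x \<in> Q"
      then have "(1/c) *\<^sub>R (matrix_inv M *v x) \<in> Q" using c M by (intro scale_Q Aut_QD Aut_Q_inv) auto
      moreover have "(c *\<^sub>R M) *v ((1/c) *\<^sub>R (matrix_inv M *v x)) = x"
        using M c by (simp add: scaleR_matrix_vector Aut_Q_def)
      ultimately show "x \<in> (*v) (c *\<^sub>R M) ` Q" by force
    qed
  qed
  ultimately show ?thesis by (simp add: Aut_Q_def)
qed

text \<open>On a segment from Q to -Q the functional w has a zero, but w vanishes nowhere over
  \<Omega>. This fixes the sign of a matrix that represents an automorphism or a simplex.\<close>

lemma one_sided:
  assumes T: "convex T" and mem: "\<And>v. v \<in> T \<Longrightarrow> v \<in> Q \<or> - v \<in> Q"
  shows "T \<subseteq> Q \<or> uminus ` T \<subseteq> Q"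
proof (rule ccontr)
  have nz: "w \<bullet> v \<noteq> 0" if "v \<in> T" for v
    using mem[OF that] pos_Q[of v] pos_Q[of "- v"] by auto
  assume "\<not> ?thesis"
  then obtain x y where xy: "x \<in> T" "y \<in> T" "x \<notin> Q" "- y \<notin> Q" by blast
  then have s: "w \<bullet> x < 0" "0 < w \<bullet> y"
    using mem[of x] mem[of y] pos_Q[of "- x"] pos_Q[of y] by auto
  define t where "t = (w \<bullet> y) / (w \<bullet> y - w \<bullet> x)"
  have t: "0 < t" "t < 1" using s by (auto simp: t_def field_simps)
  have "t *\<^sub>R x + (1 - t) *\<^sub>R y \<in> T" using t xy by (intro convexD[OF T]) auto
  then have "w \<bullet> (t *\<^sub>R x + (1 - t) *\<^sub>R y) \<noteq> 0"
    by (rule nz)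
  moreover have "w \<bullet> (t *\<^sub>R x + (1 - t) *\<^sub>R y) = t * (w \<bullet> x) + (1 - t) * (w \<bullet> y)"
    by (simp add: inner_add_right)
  moreover have "t * (w \<bullet> x) + (1 - t) * (w \<bullet> y) = 0"
    using s by (simp add: t_def field_simps)
  ultimately show False by simp
qed

text \<open>The convex set M' Q lies over \<Omega>, so either M' or -M' maps Q into Q. That the
  image is all of Q follows from g \<Omega> = \<Omega> and homogeneity.\<close>

lemma lift_exists:
  assumes g: "g \<in> pgl" and inv: "pgl_act g ` \<Omega> = \<Omega>"
  obtains M where "M \<in> Aut_Q" "g = proj_class M"
proof -
  obtain M' where M': "invertible M'" "g = proj_class M'" using g by (auto simp: pgl_def)
  have "(- M') ** (- matrix_inv M') = mat 1"
    using scaleR_matrix_mult[of "-1" M' "-1" "matrix_inv M'"] M'(1) by simp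
  then have "invertible (- M')" using invertible_right_inverse by blast
  moreover have "g = proj_class (- M')" using M' by (simp add: proj_class_minus)
  moreover have "(\<forall>v\<in>Q. M' *v v \<in> Q) \<or> (\<forall>v\<in>Q. (- M') *v v \<in> Q)"
  proof -
    have "v \<in> Q \<or> - v \<in> Q" if v: "v \<in> (*v) M' ` Q" for v
    proof -
      obtain u where u: "u \<in> Q" "v = M' *v u" using v by blast
      then have "proj_class v \<in> pgl_act g ` \<Omega>"
        using proj_class_in_\<Omega>[OF u(1)] M'(2) pgl_act_proj_class by (metis imageI)
      then show ?thesis using inv \<Omega>_cases by simp
    qed
    moreover have "convex ((*v) M' ` Q)"
      by (intro convex_linear_image matrix_vector_mul_linear convex_Q)
    ultimately have "(*v) M' ` Q \<subseteq> Q \<or> uminus ` (*v) M' ` Q \<subseteq> Q" by (intro one_sided)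
    then show ?thesis using scaleR_matrix_vector'[of "-1" M'] by auto
  qed
  ultimately obtain M where M: "invertible M" "g = proj_class M" "\<forall>v\<in>Q. M *v v \<in> Q"
    using M' by blast
  have "Q \<subseteq> (*v) M ` Q"
  proof
    fix x assume x: "x \<in> Q"
    then have "proj_class x \<in> pgl_act g ` \<Omega>" using inv proj_class_in_\<Omega> by blast
    then obtain p where p: "p \<in> \<Omega>" "proj_class x = pgl_act g p" by blast
    obtain v where v: "v \<in> Q" "p = proj_class v" using p(1) by (rule \<Omega>_rep)
    have "proj_class x = proj_class (M *v v)" using p v M by (simp add: pgl_act_proj_class)
    then obtain c where "0 < c" "x = c *\<^sub>R (M *v v)" using Q_proj_class_eq x M(3) v(1) by blast
    then have "x = M *v (c *\<^sub>R v)" "c *\<^sub>R v \<in> Q" using v by (auto simp: matrix_vector_mult_scaleR scale_Q)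
    then show "x \<in> (*v) M ` Q" by blast
  qed
  then have "M \<in> Aut_Q" using M by (auto simp: Aut_Q_def)
  then show thesis using that M by blast
qed

lemma Aut_Q_proj_class_eq:
  assumes "M \<in> Aut_Q" "N \<in> Aut_Q" "proj_class M = proj_class N"
  obtains c where "0 < c" "M = c *\<^sub>R N"
proof -
  obtain c where c: "c \<noteq> 0" "M = c *\<^sub>R N" using assms(3) by (rule proj_class_eqD)
  obtain v where "v \<in> Q" using Q_nonempty by blast
  then have v: "M *v v \<in> Q" "N *v v \<in> Q" using assms Aut_QD by auto
  then have "0 < c * (w \<bullet> (N *v v))" using c pos_Q[OF v(1)] by (simp add: scaleR_matrix_vector')
  then have "0 < c" using pos_Q[OF v(2)] by (simp add: zero_less_mult_iff)
  then show thesis using c that by blast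
qed

text \<open>Two elements of \<open>Aut_Q\<close> in one class differ by a positive factor, and the
  determinant sees its \<open>CARD('n)\<close>-th power. This upgrades identities of classes to
  identities of matrices.\<close>

lemma Aut_Q_eqI:
  assumes "M \<in> Aut_Q" "N \<in> Aut_Q" "proj_class M = proj_class N" "det M = det N"
  shows "M = N"
proof -
  obtain c where c: "0 < c" "M = c *\<^sub>R N" using Aut_Q_proj_class_eq[OF assms(1-3)] by blast
  have "M = (matrix ((*\<^sub>R) c)) ** N"
    unfolding c(2) matrix_scaleR by (simp add: vec_eq_iff matrix_matrix_mult_def mat_def if_distrib if_distribR cong: if_cong)
  then have "det M = c ^ CARD('n) * det N" by (simp add: det_mul det_matrix_scaleR)
  moreover have "det N \<noteq> 0" using assms(2) by (simp add: Aut_Q_def invertible_det_nz)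
  ultimately have "c ^ CARD('n) = 1" using assms(4) by simp
  then have "c = 1" using c(1) using power_eq_imp_eq_base[of c "CARD('n)" 1] by simp
  then show ?thesis using c(2) by simp
qed

text \<open>All positive multiples are kept instead of one representative per class, so that orbits
  of rays become orbits of vectors and a compact set of vectors can witness co-compactness.\<close>

definition lifts :: "(real^'n^'n) set set \<Rightarrow> (real^'n^'n) set" where
  "lifts G = {M \<in> Aut_Q. proj_class M \<in> G}"

lemma lifts_Aut: "M \<in> lifts G \<Longrightarrow> M \<in> Aut_Q" by (simp add: lifts_def)

lemma lifts_mult: "subgroup G pgl_group \<Longrightarrow> M \<in> lifts G \<Longrightarrow> N \<in> lifts G \<Longrightarrow> M ** N \<in> lifts G"
  by (auto simp: lifts_def Aut_Q_mult subgroup_pgl_mult)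

lemma lifts_inv: "subgroup G pgl_group \<Longrightarrow> M \<in> lifts G \<Longrightarrow> matrix_inv M \<in> lifts G"
  by (auto simp: lifts_def Aut_Q_inv subgroup_pgl_inv) (simp add: Aut_Q_def subgroup_pgl_inv)

lemma lifts_scale: "M \<in> lifts G \<Longrightarrow> 0 < c \<Longrightarrow> c *\<^sub>R M \<in> lifts G"
  by (auto simp: lifts_def Aut_Q_scale proj_class_scale)

text \<open>M N and N M have the same determinant, so equality of their classes is equality of
  matrices.\<close>

lemma lifts_commute_iff:
  assumes "M \<in> Aut_Q" "N \<in> Aut_Q"
  shows "M ** N = N ** M \<longleftrightarrow> proj_class M \<otimes>\<^bsub>pgl_group\<^esub> proj_class N = proj_class N \<otimes>\<^bsub>pgl_group\<^esub> proj_class M"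
  unfolding pgl_mult using Aut_Q_eqI[of "M ** N" "N ** M"] assms by (auto simp: Aut_Q_mult det_mul)

text \<open>Isolation of the identity of G, pulled back to a ball of matrices. Only the classes can
  be concluded to agree, because multiples of N come arbitrarily close to N.\<close>

lemma lifts_discrete:
  assumes "discrete_subgroup G"
  obtains \<delta> where "0 < \<delta>"
    "\<And>M N. M \<in> lifts G \<Longrightarrow> N \<in> lifts G \<Longrightarrow> norm (M ** matrix_inv N - mat 1) < \<delta> \<Longrightarrow> proj_class M = proj_class N"
proof -
  have G: "subgroup G pgl_group" using assms by (simp add: discrete_subgroup_def)
  then have one: "proj_class (mat 1) \<in> G" using subgroup.one_closed pgl_one by metis
  then obtain U where U: "openin pgl_top U" "U \<inter> G = {proj_class (mat 1)}"
    using assms unfolding discrete_subgroup_def by blast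
  then obtain V where V: "openin proj_top V" "U = V \<inter> pgl"
    unfolding pgl_top_def by (auto simp: openin_subtopology)
  have "mat 1 \<noteq> (0 :: real^'n^'n)" by (simp add: vec_eq_iff mat_def)
  moreover have "proj_class (mat 1) \<in> V" using U V by blast
  moreover have "open {v. v \<noteq> 0 \<and> proj_class v \<in> V}" using V by (simp add: openin_proj_top)
  ultimately obtain \<delta> where \<delta>: "0 < \<delta>" "ball (mat 1) \<delta> \<subseteq> {v. v \<noteq> 0 \<and> proj_class v \<in> V}"
    unfolding open_contains_ball by blast
  have "proj_class M = proj_class N"
    if MN: "M \<in> lifts G" "N \<in> lifts G" "norm (M ** matrix_inv N - mat 1) < \<delta>" for M N
  proof -
    let ?P = "M ** matrix_inv N"
    have "?P \<in> ball (mat 1) \<delta>" using MN(3) by (simp add: dist_norm norm_minus_commute)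
    then have "proj_class ?P \<in> V" using \<delta> by blast
    moreover have "?P \<in> lifts G" using MN G by (intro lifts_mult lifts_inv)
    ultimately have "proj_class ?P \<in> U \<inter> G"
      using V subgroup.subset[OF G] by (auto simp: lifts_def pgl_group_def)
    then have "proj_class ?P = proj_class (mat 1)" using U by blast
    then obtain c where c: "c \<noteq> 0" "?P = c *\<^sub>R mat 1" by (rule proj_class_eqD)
    have N: "invertible N" using MN by (simp add: lifts_def Aut_Q_def)
    have "M = ?P ** N" using N by (simp flip: matrix_mul_assoc)
    also have "\<dots> = c *\<^sub>R N" using scaleR_matrix_mult[of c "mat 1" 1 N] c by simp
    finally show ?thesis using c by (simp add: proj_class_scale)
  qed
  then show thesis using that \<delta> by blast
qed

section \<open>Transfer of closedness and co-compactness between projective sets and cones\<close>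

lemma closedin_cone:
  assumes "closedin (subtopology proj_top \<Omega>) C"
  shows "Q \<inter> closure {v \<in> Q. proj_class v \<in> C} \<subseteq> {v \<in> Q. proj_class v \<in> C}"
proof -
  obtain T where T: "closedin proj_top T" "C = T \<inter> \<Omega>" using assms by (auto simp: closedin_subtopology)
  then have "openin proj_top (topspace proj_top - T)" by (simp add: closedin_def)
  then have o: "open {v. v \<noteq> 0 \<and> proj_class v \<in> topspace proj_top - T}" by (simp add: openin_proj_top)
  have "closure {v \<in> Q. proj_class v \<in> C} \<subseteq> - {v. v \<noteq> 0 \<and> proj_class v \<in> topspace proj_top - T}"
    using T o by (intro closure_minimal) auto
  moreover have "proj_class v \<in> C" if "v \<in> Q" "v \<notin> {v. v \<noteq> 0 \<and> proj_class v \<in> topspace proj_top - T}" for v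
    using that Q_nonzero[of v] proj_class_in_space[of v] proj_class_in_\<Omega>[of v] T
    by (auto simp: topspace_proj_top)
  ultimately show ?thesis by blast
qed

text \<open>Openness in \<open>proj_top\<close> is tested on all nonzero vectors, hence on both Q
  and -Q; homogeneity makes Z the full preimage in Q of its classes.\<close>

lemma closedin_proj_class:
  assumes Z: "Z \<subseteq> Q" "Q \<inter> closure Z \<subseteq> Z" "\<And>c x. 0 < c \<Longrightarrow> x \<in> Z \<Longrightarrow> c *\<^sub>R x \<in> Z"
  shows "closedin (subtopology proj_top \<Omega>) (proj_class ` Z)"
proof -
  have ZO: "proj_class ` Z \<subseteq> \<Omega>" using Z(1) proj_class_in_\<Omega> by blast
  have mem: "proj_class v \<in> \<Omega> - proj_class ` Z \<longleftrightarrow> v \<in> Q - closure Z" if v: "v \<in> Q" for v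
  proof
    assume "proj_class v \<in> \<Omega> - proj_class ` Z"
    then show "v \<in> Q - closure Z" using v Z by auto
  next
    assume *: "v \<in> Q - closure Z"
    have "proj_class v \<notin> proj_class ` Z"
    proof
      assume "proj_class v \<in> proj_class ` Z"
      then obtain z where z: "z \<in> Z" "proj_class v = proj_class z" by blast
      then obtain c where "0 < c" "v = c *\<^sub>R z" using Q_proj_class_eq[OF v] Z(1) by blast
      then have "v \<in> Z" using z Z(3) by blast
      then show False using * closure_subset by auto
    qed
    then show "proj_class v \<in> \<Omega> - proj_class ` Z" using v proj_class_in_\<Omega> by blast
  qed
  have "{v. v \<noteq> 0 \<and> proj_class v \<in> \<Omega> - proj_class ` Z} = (Q - closure Z) \<union> uminus ` (Q - closure Z)"
    (is "?L = ?R")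
  proof
    show "?L \<subseteq> ?R"
    proof
      fix v assume v: "v \<in> ?L"
      then have "v \<in> Q \<or> - v \<in> Q" using \<Omega>_cases by blast
      then show "v \<in> ?R"
        using mem[of v] mem[of "- v"] v by (auto simp: proj_class_minus image_iff intro: bexI[of _ "- v"])
    qed
    have "v \<noteq> 0 \<and> proj_class v \<in> \<Omega> - proj_class ` Z" if "v \<in> Q - closure Z" for v
      using mem[of v] Q_nonzero[of v] that by blast
    note aux = this
    show "?R \<subseteq> ?L"
    proof
      fix v assume "v \<in> ?R"
      then have "v \<in> Q - closure Z \<or> - v \<in> Q - closure Z" by auto
      then show "v \<in> ?L"
        using aux[of v] aux[of "- v"] unfolding proj_class_minus neg_equal_0_iff_equal mem_Collect_eq by blast
    qed
  qed
  moreover have "open (Q - closure Z)" using open_Q by (intro open_Diff) auto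
  moreover have "open (uminus ` (Q - closure Z))" using \<open>open (Q - closure Z)\<close> by (rule open_negations)
  ultimately have "openin proj_top (\<Omega> - proj_class ` Z)"
    unfolding openin_proj_top using \<Omega>_space by auto
  then have "openin (subtopology proj_top \<Omega>) (\<Omega> - proj_class ` Z)"
    by (auto simp: openin_subtopology)
  then show ?thesis
    using ZO \<Omega>_space unfolding closedin_def topspace_subtopology topspace_proj_top
    by (simp add: Int_absorb1)
qed

text \<open>A compact set of classes is covered by images of balls whose closed balls stay in Q. The
  finitely many closed balls of a subcover, cut down to the cone over C, form the compact set of
  vectors.\<close>

lemma cocompact_lift:
  assumes G: "subgroup G pgl_group" and GO: "\<And>g. g \<in> G \<Longrightarrow> pgl_act g ` \<Omega> = \<Omega>"
    and C: "C \<subseteq> \<Omega>" "closedin (subtopology proj_top \<Omega>) C" and coc: "acts_cocompactly G C"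
  obtains K where "compact K" "K \<subseteq> {v \<in> Q. proj_class v \<in> C}"
    "\<And>v. v \<in> Q \<Longrightarrow> proj_class v \<in> C \<Longrightarrow> \<exists>M\<in>lifts G. M *v v \<in> K"
proof -
  obtain K0 where K0: "K0 \<subseteq> C" "compactin proj_top K0" "(\<Union>g\<in>G. pgl_act g ` K0) = C"
    using coc by (auto simp: acts_cocompactly_def)
  have "\<forall>v\<in>Q. \<exists>r>0. cball v r \<subseteq> Q" using open_Q open_contains_cball by blast
  then obtain r where r: "\<And>v. v \<in> Q \<Longrightarrow> 0 < r v" "\<And>v. v \<in> Q \<Longrightarrow> cball v (r v) \<subseteq> Q" by metis
  define U where "U v = proj_class ` ball v (r v)" for v
  have opU: "openin proj_top (U v)" if v: "v \<in> Q" for v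
  proof -
    have bQ: "ball v (r v) \<subseteq> Q" using r(2)[OF v] ball_subset_cball by blast
    \<comment> \<open>The preimage of U v is the union of all nonzero multiples of the ball, each of
      which is open.\<close>
    have "{x. x \<noteq> 0 \<and> proj_class x \<in> U v} = (\<Union>c\<in>-{0}. (\<lambda>x. c *\<^sub>R x) ` ball v (r v))"
    proof
      show "{x. x \<noteq> 0 \<and> proj_class x \<in> U v} \<subseteq> (\<Union>c\<in>-{0}. (\<lambda>x. c *\<^sub>R x) ` ball v (r v))"
      proof clarify
        fix x assume "proj_class x \<in> U v"
        then obtain y where y: "y \<in> ball v (r v)" "proj_class x = proj_class y" by (auto simp: U_def)
        obtain c where "c \<noteq> 0" "x = c *\<^sub>R y" using y(2) by (rule proj_class_eqD)
        then show "x \<in> (\<Union>c\<in>-{0}. (\<lambda>x. c *\<^sub>R x) ` ball v (r v))" using y(1) by blast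
      qed
      show "(\<Union>c\<in>-{0}. (\<lambda>x. c *\<^sub>R x) ` ball v (r v)) \<subseteq> {x. x \<noteq> 0 \<and> proj_class x \<in> U v}"
      proof clarify
        fix c :: real and x assume *: "c \<noteq> 0" "x \<in> ball v (r v)"
        then have "x \<noteq> 0" using bQ Q_nonzero by blast
        then show "c *\<^sub>R x \<noteq> 0 \<and> proj_class (c *\<^sub>R x) \<in> U v"
          using * by (simp add: proj_class_scale U_def del: mem_ball)
      qed
    qed
    moreover have "open (\<Union>c\<in>-{0}. (\<lambda>x. c *\<^sub>R x) ` ball v (r v))"
      by (intro open_UN ballI open_scaling) auto
    moreover have "U v \<subseteq> proj_space" using bQ Q_nonzero proj_class_in_space unfolding U_def by blast
    ultimately show ?thesis by (simp add: openin_proj_top)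
  qed
  have cover: "K0 \<subseteq> \<Union>(U ` Q)"
  proof
    fix p assume "p \<in> K0"
    then have "p \<in> \<Omega>" using K0 C by blast
    then obtain v where "v \<in> Q" "p = proj_class v" by (rule \<Omega>_rep)
    then show "p \<in> \<Union>(U ` Q)" using r(1) by (force simp: U_def)
  qed
  obtain \<F> where \<F>: "finite \<F>" "\<F> \<subseteq> U ` Q" "K0 \<subseteq> \<Union>\<F>"
    using compactinD[OF K0(2) _ cover] opU by blast
  obtain F where F: "F \<subseteq> Q" "finite F" "\<F> = U ` F" using finite_subset_image[OF \<F>(1,2)] by blast
  define Cc where "Cc = {v \<in> Q. proj_class v \<in> C}"
  define K where "K = (\<Union>v\<in>F. cball v (r v)) \<inter> closure Cc"
  have "compact K" unfolding K_def using F by (intro compact_Int_closed compact_UN) auto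
  moreover have "K \<subseteq> Cc" using F r(2) closedin_cone[OF C(2)] unfolding K_def Cc_def by blast
  moreover have "\<exists>M\<in>lifts G. M *v v \<in> K" if v: "v \<in> Q" "proj_class v \<in> C" for v
  proof -
    obtain g k where gk: "g \<in> G" "k \<in> K0" "proj_class v = pgl_act g k" using v K0(3) by blast
    then obtain f y where f: "f \<in> F" "y \<in> ball f (r f)" "k = proj_class y"
      using \<F>(3) F(3) unfolding U_def by blast
    have yQ: "y \<in> Q" using f F r(2) ball_subset_cball by blast
    have yC: "y \<in> Cc" using yQ f gk K0(1) by (auto simp: Cc_def)
    have "g \<in> pgl" using gk subgroup.subset[OF G] by (auto simp: pgl_group_def)
    then obtain M where M: "M \<in> Aut_Q" "g = proj_class M" using lift_exists GO gk by blast
    have "proj_class v = proj_class (M *v y)" using gk f M by (simp add: pgl_act_proj_class)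
    then obtain c where c: "0 < c" "v = c *\<^sub>R (M *v y)" using Q_proj_class_eq[OF v(1) Aut_QD[OF M(1) yQ]] by blast
    have Mg: "M \<in> lifts G" using M gk by (simp add: lifts_def)
    \<comment> \<open>Scaling the lift by 1/c carries v to y itself and not merely to the ray of
      y.\<close>
    have "(1/c) *\<^sub>R matrix_inv M \<in> lifts G" using c by (intro lifts_scale lifts_inv G Mg) auto
    moreover have "((1/c) *\<^sub>R matrix_inv M) *v v = y"
      using c M by (simp add: scaleR_matrix_vector Aut_Q_def)
    moreover have "y \<in> K" unfolding K_def
    proof
      show "y \<in> (\<Union>v\<in>F. cball v (r v))" using f(1,2) by (intro UN_I[of f]) auto
      show "y \<in> closure Cc" using yC by (rule subsetD[OF closure_subset])
    qed
    ultimately show ?thesis by (intro bexI[of _ "(1/c) *\<^sub>R matrix_inv M"]) simp_all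
  qed
  ultimately show thesis using that unfolding Cc_def by blast
qed

end

section \<open>Co-compactness of a maximal Abelian subgroup\<close>

text \<open>The form in which maximality enters: the co-compactness argument produces an element of
  \<Lambda> that commutes with A, and it has to be seen to lie in A.\<close>

lemma commuting_in_maximal_abelian:
  assumes \<Lambda>: "subgroup \<Lambda> pgl_group" and A: "maximal_abelian_subgroup A \<Lambda>" and k: "k \<in> \<Lambda>"
    and comm: "\<And>a. a \<in> A \<Longrightarrow> k \<otimes>\<^bsub>pgl_group\<^esub> a = a \<otimes>\<^bsub>pgl_group\<^esub> k"
  shows "k \<in> (A :: (real^'n^'n) set set)"
proof -
  interpret group "pgl_group :: (real^'n^'n) set monoid" by (rule group_pgl)
  define cen where "cen S = {g \<in> \<Lambda>. \<forall>s\<in>S. g \<otimes>\<^bsub>pgl_group\<^esub> s = s \<otimes>\<^bsub>pgl_group\<^esub> g}" for S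
  have sub: "\<Lambda> \<subseteq> carrier pgl_group" using \<Lambda> by (rule subgroup.subset)
  have cen_subgroup: "subgroup (cen S) pgl_group" if S: "S \<subseteq> \<Lambda>" for S
  proof (rule subgroupI)
    show "cen S \<subseteq> carrier pgl_group" using sub by (auto simp: cen_def)
    have "\<one>\<^bsub>pgl_group\<^esub> \<in> cen S"
      using S sub subgroup.one_closed[OF \<Lambda>] by (auto simp: cen_def)
    then show "cen S \<noteq> {}" by blast
  next
    fix a assume a: "a \<in> cen S"
    then have ac: "a \<in> carrier pgl_group" using sub by (auto simp: cen_def)
    have "inv\<^bsub>pgl_group\<^esub> a \<otimes>\<^bsub>pgl_group\<^esub> s = s \<otimes>\<^bsub>pgl_group\<^esub> inv\<^bsub>pgl_group\<^esub> a" if s: "s \<in> S" for s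
    proof -
      have sc: "s \<in> carrier pgl_group" using s S sub by blast
      have "a \<otimes>\<^bsub>pgl_group\<^esub> s = s \<otimes>\<^bsub>pgl_group\<^esub> a" using a s by (simp add: cen_def)
      then have "a \<otimes>\<^bsub>pgl_group\<^esub> (s \<otimes>\<^bsub>pgl_group\<^esub> inv\<^bsub>pgl_group\<^esub> a) = s \<otimes>\<^bsub>pgl_group\<^esub> a \<otimes>\<^bsub>pgl_group\<^esub> inv\<^bsub>pgl_group\<^esub> a" using ac sc by (simp flip: m_assoc)
      also have "\<dots> = s" using ac sc by (simp add: m_assoc)
      finally show ?thesis using ac sc inv_solve_left[of "s \<otimes>\<^bsub>pgl_group\<^esub> inv\<^bsub>pgl_group\<^esub> a" a s] by simp
    qed
    then show "inv\<^bsub>pgl_group\<^esub> a \<in> cen S"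
      using a subgroup.m_inv_closed[OF \<Lambda>] by (auto simp: cen_def)
  next
    fix a b assume ab: "a \<in> cen S" "b \<in> cen S"
    have "a \<otimes>\<^bsub>pgl_group\<^esub> b \<otimes>\<^bsub>pgl_group\<^esub> s = s \<otimes>\<^bsub>pgl_group\<^esub> (a \<otimes>\<^bsub>pgl_group\<^esub> b)" if s: "s \<in> S" for s
    proof -
      have c: "a \<in> carrier pgl_group" "b \<in> carrier pgl_group" "s \<in> carrier pgl_group"
        using ab s S sub by (auto simp: cen_def)
      have "a \<otimes>\<^bsub>pgl_group\<^esub> b \<otimes>\<^bsub>pgl_group\<^esub> s = a \<otimes>\<^bsub>pgl_group\<^esub> (s \<otimes>\<^bsub>pgl_group\<^esub> b)"
        using ab s c by (simp add: m_assoc cen_def)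
      also have "\<dots> = s \<otimes>\<^bsub>pgl_group\<^esub> a \<otimes>\<^bsub>pgl_group\<^esub> b"
        using ab s c by (simp add: cen_def flip: m_assoc)
      finally show ?thesis using c by (simp add: m_assoc)
    qed
    then show "a \<otimes>\<^bsub>pgl_group\<^esub> b \<in> cen S"
      using ab subgroup.m_closed[OF \<Lambda>] by (auto simp: cen_def)
  qed
  define S where "S = insert k A"
  have AL: "A \<subseteq> \<Lambda>" and Aab: "\<And>a b. a \<in> A \<Longrightarrow> b \<in> A \<Longrightarrow> a \<otimes>\<^bsub>pgl_group\<^esub> b = b \<otimes>\<^bsub>pgl_group\<^esub> a"
    using A by (auto simp: maximal_abelian_subgroup_def)
  have SL: "S \<subseteq> \<Lambda>" using AL k by (auto simp: S_def)
  have ScS: "S \<subseteq> cen S" using SL Aab comm by (auto simp: S_def cen_def)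
  have cL: "cen S \<subseteq> \<Lambda>" by (auto simp: cen_def)
  \<comment> \<open>The double centralizer of a commuting set is an Abelian subgroup containing it.\<close>
  define B where "B = cen (cen S)"
  have "subgroup B pgl_group" unfolding B_def by (rule cen_subgroup[OF cL])
  moreover have SB: "S \<subseteq> B" unfolding B_def using SL by (auto simp: cen_def)
  moreover have "B \<subseteq> \<Lambda>" by (auto simp: B_def cen_def)
  moreover have "B \<subseteq> cen S" using ScS by (auto simp: B_def cen_def)
  then have "\<forall>a\<in>B. \<forall>b\<in>B. a \<otimes>\<^bsub>pgl_group\<^esub> b = b \<otimes>\<^bsub>pgl_group\<^esub> a"
    unfolding B_def by (auto simp: cen_def)
  ultimately have "B = A" using A unfolding maximal_abelian_subgroup_def S_def by (metis insert_subset)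
  then show ?thesis using SB by (simp add: S_def)
qed

context projective_cone begin

text \<open>Points of the open cone are order units, so order bounds l and m exist for any
  automorphism at a given point.\<close>

lemma absorbing: assumes "x \<in> Q" obtains t where "0 < t" "x - t *\<^sub>R y \<in> Q"
proof -
  obtain e where e: "0 < e" "ball x e \<subseteq> Q" using open_Q assms open_contains_ball by blast
  let ?t = "e / (norm y + 1)"
  have n: "norm y + 1 > 0" using norm_ge_zero[of y] by linarith
  have t: "0 < ?t" using e n by simp
  have "norm (?t *\<^sub>R y) < e" using e(1) n by (simp add: field_simps)
  then have "x - ?t *\<^sub>R y \<in> ball x e" by (simp add: dist_norm)
  then show thesis using that[of ?t] t e by blast
qed

text \<open>Each x in Y is carried into K by some g x. Conjugating F by g x keeps the order bounds,
  now at a point of K, so only finitely many tuples of conjugate classes occur. If y and z have the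
  same tuple, then k = (g z)^-1 (g y) centralizes A, hence lies in A, and carries y into (g z)^-1 K.
  One z per tuple suffices.\<close>

lemma maximal_abelian_cocompact_subcone:
  assumes \<Lambda>: "discrete_subgroup \<Lambda>" and A: "maximal_abelian_subgroup A \<Lambda>"
    and GO: "\<And>g. g \<in> \<Lambda> \<Longrightarrow> pgl_act g ` \<Omega> = \<Omega>"
    and C: "invariant_subcone (lifts \<Lambda>) C"
    and K: "compact K" "K \<subseteq> C" and coc: "\<And>v. v \<in> C \<Longrightarrow> \<exists>M\<in>lifts \<Lambda>. M *v v \<in> K"
  obtains Y K' where "invariant_subcone (lifts A) Y" "Y \<subseteq> C" "compact K'" "K' \<subseteq> Y"
    "\<And>y. y \<in> Y \<Longrightarrow> \<exists>M\<in>lifts A. M *v y \<in> K'"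
proof -
  have sL: "subgroup \<Lambda> pgl_group" using \<Lambda> by (simp add: discrete_subgroup_def)
  have AL: "A \<subseteq> \<Lambda>" using A by (simp add: maximal_abelian_subgroup_def)
  have lAL: "lifts A \<subseteq> lifts \<Lambda>" using AL by (auto simp: lifts_def)
  have lQ: "lifts \<Lambda> \<subseteq> Aut_Q" by (auto simp: lifts_def)
  have commA: "M ** N = N ** M" if "M \<in> lifts A" "N \<in> lifts A" for M N
    using lifts_commute_iff[of M N] that A by (simp add: lifts_def maximal_abelian_subgroup_def)
  have CQ: "C \<subseteq> Q" and Cne: "C \<noteq> {}" and Ccv: "convex C" and Ccl: "Q \<inter> closure C \<subseteq> C"
    and Csc: "\<And>c x. 0 < c \<Longrightarrow> x \<in> C \<Longrightarrow> c *\<^sub>R x \<in> C"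
    and Cinv: "\<And>M x. M \<in> lifts \<Lambda> \<Longrightarrow> x \<in> C \<Longrightarrow> M *v x \<in> C"
    using C by (auto simp: invariant_subcone_def)
  \<comment> \<open>Commuting with a basis of the span of the lifts of \<open>A\<close> suffices, so \<open>A\<close> need not be finitely generated.\<close>
  obtain F where F: "F \<subseteq> lifts A" "independent F" "lifts A \<subseteq> span F"
    using maximal_independent_subset by blast
  have finF: "finite F" using F(2) independent_imp_finite by blast
  have FQ: "a \<in> Aut_Q" if "a \<in> F" for a using that F(1) lAL lQ by blast
  obtain x0 where x0: "x0 \<in> C" using Cne by blast
  \<comment> \<open>The bounds l and m are read off at x0, so that x0 lies in Y.\<close>
  have "\<forall>a\<in>F. \<exists>l. 0 < l \<and> a *v x0 - l *\<^sub>R x0 \<in> Q"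
    using absorbing[OF Aut_QD[OF FQ]] x0 CQ by (metis subsetD)
  then obtain l where l: "\<And>a. a \<in> F \<Longrightarrow> 0 < l a \<and> a *v x0 - l a *\<^sub>R x0 \<in> Q" by metis
  have "\<forall>a\<in>F. \<exists>m. m *\<^sub>R x0 - a *v x0 \<in> Q"
  proof
    fix a assume "a \<in> F"
    obtain t where t: "0 < t" "x0 - t *\<^sub>R (a *v x0) \<in> Q" using absorbing x0 CQ by blast
    then have "(1/t) *\<^sub>R (x0 - t *\<^sub>R (a *v x0)) \<in> Q" by (intro scale_Q) auto
    then have "(1/t) *\<^sub>R x0 - a *v x0 \<in> Q" using t by (simp add: scaleR_diff_right)
    then show "\<exists>m. m *\<^sub>R x0 - a *v x0 \<in> Q" by blast
  qed
  then obtain m where m: "\<And>a. a \<in> F \<Longrightarrow> m a *\<^sub>R x0 - a *v x0 \<in> Q" by metis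
  define W where "W a = {x. a *v x - l a *\<^sub>R x \<in> closure Q \<and> m a *\<^sub>R x - a *v x \<in> closure Q}" for a
  define Y where "Y = C \<inter> (\<Inter>a\<in>F. W a)"
  have Wcl: "closed (W a)" for a
  proof -
    have "W a = ((\<lambda>x. a *v x - l a *\<^sub>R x) -` closure Q) \<inter> ((\<lambda>x. m a *\<^sub>R x - a *v x) -` closure Q)"
      by (auto simp: W_def)
    moreover have "closed ((\<lambda>x. a *v x - l a *\<^sub>R x) -` closure Q)"
      by (intro continuous_closed_vimage closed_closure) (auto intro!: continuous_intros matrix_vector_mult_linear_continuous_at)
    moreover have "closed ((\<lambda>x. m a *\<^sub>R x - a *v x) -` closure Q)"
      by (intro continuous_closed_vimage closed_closure) (auto intro!: continuous_intros matrix_vector_mult_linear_continuous_at)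
    ultimately show ?thesis by auto
  qed
  have Wcv: "convex (W a)" for a
  proof (rule convexI)
    fix x y and u v :: real assume *: "x \<in> W a" "y \<in> W a" "0 \<le> u" "0 \<le> v" "u + v = 1"
    have "u *\<^sub>R (a *v x - l a *\<^sub>R x) + v *\<^sub>R (a *v y - l a *\<^sub>R y) \<in> closure Q"
      "u *\<^sub>R (m a *\<^sub>R x - a *v x) + v *\<^sub>R (m a *\<^sub>R y - a *v y) \<in> closure Q"
      using * by (auto simp: W_def intro!: closure_add closure_scale)
    then show "u *\<^sub>R x + v *\<^sub>R y \<in> W a"
      by (simp add: W_def matrix_vector_right_distrib matrix_vector_mult_scaleR algebra_simps)
  qed
  have Wsc: "c *\<^sub>R x \<in> W a" if "0 < c" "x \<in> W a" for c x a
  proof -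
    have "c *\<^sub>R (a *v x - l a *\<^sub>R x) \<in> closure Q" "c *\<^sub>R (m a *\<^sub>R x - a *v x) \<in> closure Q"
      using that by (auto simp: W_def intro!: closure_scale)
    then show ?thesis by (simp add: W_def matrix_vector_mult_scaleR algebra_simps)
  qed
  have Wconj: "(h ** a ** matrix_inv h) *v (h *v x) - l a *\<^sub>R (h *v x) \<in> closure Q \<and>
      m a *\<^sub>R (h *v x) - (h ** a ** matrix_inv h) *v (h *v x) \<in> closure Q"
    if "h \<in> lifts \<Lambda>" "x \<in> W a" for h a x
  proof -
    have hQ: "h \<in> Aut_Q" using that lQ by blast
    have "h *v (a *v x - l a *\<^sub>R x) \<in> closure Q" "h *v (m a *\<^sub>R x - a *v x) \<in> closure Q"
      using that(2) by (auto simp: W_def intro!: Aut_Q_closure hQ)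
    moreover have "(h ** a ** matrix_inv h) *v (h *v x) = h *v (a *v x)"
      using hQ by (simp add: Aut_Q_def flip: matrix_vector_mul_assoc)
    ultimately show ?thesis by (simp add: matrix_vector_mult_diff_distrib matrix_vector_mult_scaleR)
  qed
  \<comment> \<open>A lift of an element of A conjugates a to itself, so \<open>Wconj\<close>
    becomes invariance of W a.\<close>
  have Winv: "h *v x \<in> W a" if "h \<in> lifts A" "a \<in> F" "x \<in> W a" for h a x
  proof -
    have "invertible h" using that lAL lQ by (auto simp: Aut_Q_def)
    then have "h ** a ** matrix_inv h = a"
      using commA[of h a] that(1,2) F(1) by (simp add: subset_iff flip: matrix_mul_assoc)
    then show ?thesis using Wconj[of h x a] that lAL by (auto simp: W_def)
  qed
  have iY: "invariant_subcone (lifts A) Y"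
    unfolding invariant_subcone_def
  proof (intro conjI allI ballI impI)
    have "x0 \<in> Y" using x0 l m Q_sub by (auto simp: Y_def W_def)
    then show "Y \<noteq> {}" by blast
    show "Y \<subseteq> Q" using CQ by (auto simp: Y_def)
    show "convex Y" unfolding Y_def by (intro convex_Int Ccv convex_INT Wcv)
    show "c *\<^sub>R x \<in> Y" if "0 < c" "x \<in> Y" for c x using that Csc Wsc by (auto simp: Y_def)
    have "closure Y \<subseteq> closure C" unfolding Y_def by (intro closure_mono) auto
    moreover have "closure Y \<subseteq> (\<Inter>a\<in>F. W a)" unfolding Y_def
      using Wcl by (intro closure_minimal) auto
    ultimately show "Q \<inter> closure Y \<subseteq> Y" using Ccl unfolding Y_def by blast
    show "M *v x \<in> Y" if "M \<in> lifts A" "x \<in> Y" for M x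
      using that Winv Cinv lAL by (auto simp: Y_def)
  qed
  have "\<forall>x\<in>Y. \<exists>g\<in>lifts \<Lambda>. g *v x \<in> K" using coc by (auto simp: Y_def)
  then obtain g where g: "\<And>x. x \<in> Y \<Longrightarrow> g x \<in> lifts \<Lambda> \<and> g x *v x \<in> K" by metis
  obtain \<delta> where \<delta>: "0 < \<delta>" "\<And>M N. M \<in> lifts \<Lambda> \<Longrightarrow> N \<in> lifts \<Lambda> \<Longrightarrow>
      norm (M ** matrix_inv N - mat 1) < \<delta> \<Longrightarrow> proj_class M = proj_class N"
    using lifts_discrete[OF \<Lambda>] by blast
  define X where "X a = {proj_class M | M. M \<in> lifts \<Lambda> \<and>
    (\<exists>x\<in>K. M *v x - l a *\<^sub>R x \<in> closure Q \<and> m a *\<^sub>R x - M *v x \<in> closure Q)}" for a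
  have finX: "finite (X a)" if "a \<in> F" for a
    unfolding X_def using K CQ l[OF that] \<delta> lQ
    by (intro finite_bounded_displacement[where \<delta> = \<delta>]) auto
  define \<tau> where "\<tau> x = (\<lambda>a\<in>F. proj_class (g x ** a ** matrix_inv (g x)))" for x
  have "\<tau> ` Y \<subseteq> Pi\<^sub>E F X"
  proof (rule image_subsetI)
    fix x assume x: "x \<in> Y"
    have "proj_class (g x ** a ** matrix_inv (g x)) \<in> X a" if a: "a \<in> F" for a
    proof -
      have "g x ** a ** matrix_inv (g x) \<in> lifts \<Lambda>"
        using g[OF x] a F(1) lAL by (intro lifts_mult lifts_inv sL) auto
      then show ?thesis using Wconj[of "g x" x a] g[OF x] x a unfolding X_def Y_def by blast
    qed
    then show "\<tau> x \<in> Pi\<^sub>E F X" by (auto simp: \<tau>_def)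
  qed
  then have "finite (\<tau> ` Y)" using finite_PiE[OF finF, of X] finX finite_subset by blast
  then obtain Y0 where Y0: "Y0 \<subseteq> Y" "finite Y0" "\<tau> ` Y = \<tau> ` Y0" by (meson finite_subset_image subset_refl)
  \<comment> \<open>Intersecting with \<open>closure Y\<close> keeps K' compact, and inside Q this
    closure is Y itself.\<close>
  define K' where "K' = (\<Union>z\<in>Y0. (*v) (matrix_inv (g z)) ` K) \<inter> closure Y"
  have K'Q: "(*v) (matrix_inv (g z)) ` K \<subseteq> Q" if "z \<in> Y0" for z
  proof -
    have "matrix_inv (g z) \<in> Aut_Q" using g that Y0(1) lQ Aut_Q_inv by blast
    then show ?thesis using K(2) CQ Aut_QD by blast
  qed
  have "compact K'" unfolding K'_def using Y0(2) K(1)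
    by (intro compact_Int_closed compact_UN compact_continuous_image)
      (auto intro: continuous_on_subset[OF matrix_vector_mult_linear_continuous_on])
  moreover have "K' \<subseteq> Y" using K'Q closure_subcone(2)[OF iY] unfolding K'_def by blast
  moreover have "\<exists>M\<in>lifts A. M *v y \<in> K'" if y: "y \<in> Y" for y
  proof -
    obtain z where z: "z \<in> Y0" "\<tau> y = \<tau> z" using y Y0(3) by blast
    have zY: "z \<in> Y" using z Y0 by blast
    have gy: "g y \<in> lifts \<Lambda>" and gz: "g z \<in> lifts \<Lambda>" using g y zY by auto
    have iy: "invertible (g y)" and iz: "invertible (g z)" using gy gz lQ by (auto simp: Aut_Q_def)
    define k where "k = matrix_inv (g z) ** g y"
    have k: "k \<in> lifts \<Lambda>" unfolding k_def using gy gz by (intro lifts_mult lifts_inv sL)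
    have kF: "k ** a = a ** k" if a: "a \<in> F" for a
    proof -
      have aQ: "a \<in> Aut_Q" using a FQ by blast
      \<comment> \<open>Conjugates of one matrix share its determinant, so equality of their classes
        is equality of the matrices.\<close>
      have "g y ** a ** matrix_inv (g y) = g z ** a ** matrix_inv (g z)"
      proof (rule Aut_Q_eqI)
        show "g y ** a ** matrix_inv (g y) \<in> Aut_Q" "g z ** a ** matrix_inv (g z) \<in> Aut_Q"
          using lifts_Aut[OF gy] lifts_Aut[OF gz] aQ by (auto intro!: Aut_Q_mult Aut_Q_inv)
        show "proj_class (g y ** a ** matrix_inv (g y)) = proj_class (g z ** a ** matrix_inv (g z))"
          using fun_cong[OF z(2), of a] a by (simp add: \<tau>_def)
        have "det M * det (matrix_inv M) = 1" if "invertible M" for M :: "real^'n^'n"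
          using that by (simp flip: det_mul)
        then show "det (g y ** a ** matrix_inv (g y)) = det (g z ** a ** matrix_inv (g z))"
          using iy iz by (simp add: det_mul mult_ac) 
      qed
      then have "matrix_inv (g z) ** (g y ** a ** matrix_inv (g y)) ** g y = matrix_inv (g z) ** (g z ** a ** matrix_inv (g z)) ** g y"
        by simp
      then have "matrix_inv (g z) ** g y ** a ** (matrix_inv (g y) ** g y) = (matrix_inv (g z) ** g z) ** a ** matrix_inv (g z) ** g y"
        by (simp only: matrix_mul_assoc)
      then show ?thesis using iy iz by (simp add: k_def matrix_mul_assoc)
    qed
    \<comment> \<open>Commuting with k is a linear condition, so it extends from F to every lift of
      A.\<close>
    have "span F \<subseteq> {a. k ** a = a ** k}"
    proof (rule span_minimal)
      show "F \<subseteq> {a. k ** a = a ** k}" using kF by blast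
      have "k ** (c *\<^sub>R a) = c *\<^sub>R (k ** a)" "(c *\<^sub>R a) ** k = c *\<^sub>R (a ** k)" for c and a :: "real^'n^'n"
        using scaleR_matrix_mult[of 1 k c a] scaleR_matrix_mult[of c a 1 k] by auto
      moreover have "(a + b) ** k = a ** k + b ** k" for a b :: "real^'n^'n"
        by (simp add: vec_eq_iff matrix_matrix_mult_def sum.distrib algebra_simps)
      ultimately show "subspace {a. k ** a = a ** k}"
        by (auto simp: subspace_def matrix_add_ldistrib)
    qed
    then have kA: "k ** a = a ** k" if "a \<in> lifts A" for a using that F(3) by blast
    have "proj_class k \<in> A"
    proof (rule commuting_in_maximal_abelian[OF sL A])
      show "proj_class k \<in> \<Lambda>" using k by (simp add: lifts_def)
      fix a assume a: "a \<in> A"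
      then have "a \<in> pgl" "a \<in> \<Lambda>" using AL subgroup.subset[OF sL] by (auto simp: pgl_group_def)
      then obtain M where M: "M \<in> Aut_Q" "a = proj_class M" using lift_exists GO by blast
      then have "M \<in> lifts A" using a by (simp add: lifts_def)
      then show "proj_class k \<otimes>\<^bsub>pgl_group\<^esub> a = a \<otimes>\<^bsub>pgl_group\<^esub> proj_class k"
        using kA M lifts_commute_iff[OF lifts_Aut[OF k] M(1)] by simp
    qed
    then have kl: "k \<in> lifts A" using k by (simp add: lifts_def)
    have "k *v y = matrix_inv (g z) *v (g y *v y)" by (simp add: k_def matrix_vector_mul_assoc)
    then have "k *v y \<in> (*v) (matrix_inv (g z)) ` K" using g[OF y] by blast
    moreover have "k *v y \<in> Y" using kl y iY by (auto simp: invariant_subcone_def)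
    ultimately have "k *v y \<in> K'" unfolding K'_def using z(1) closure_subset by blast
    then show ?thesis using kl by blast
  qed
  ultimately show thesis using that[OF iY, of K'] by (simp add: Y_def)
qed

end

section \<open>Lattices in Abelian groups\<close>

text \<open>Independence of the v j makes the b j generate a free subgroup B. Subtracting integer
  parts of coordinates gives every coset of B a representative over the fundamental parallelepiped
  of v, and only finitely many group elements lie over it. As v is a real basis and not an integral
  basis of the image of \<Phi>, B may be proper; counting elements of G and not their images also
  bounds the kernel of \<Phi>.\<close>

lemma (in comm_group) finite_index_integer_lattice:
  fixes \<Phi> :: "'a \<Rightarrow> 'v::real_vector" and v :: "nat \<Rightarrow> 'v"
  assumes add: "\<And>x y. x \<in> carrier G \<Longrightarrow> y \<in> carrier G \<Longrightarrow> \<Phi> (x \<otimes> y) = \<Phi> x + \<Phi> y"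
    and b: "\<And>j. j < m \<Longrightarrow> b j \<in> carrier G \<and> \<Phi> (b j) = v j"
    and v: "inj_on v {..<m}" "independent (v ` {..<m})"
    and sp: "\<And>x. x \<in> carrier G \<Longrightarrow> \<Phi> x \<in> span (v ` {..<m})"
    and fin: "finite {x \<in> carrier G. \<exists>r. (\<forall>j<m. 0 \<le> r j \<and> r j \<le> (1::real)) \<and> \<Phi> x = (\<Sum>j<m. r j *\<^sub>R v j)}"
  obtains B where "subgroup B G" "finite {B #> a | a. a \<in> carrier G}"
    "G\<lparr>carrier := B\<rparr> \<cong> product_group {..<m} (\<lambda>_. integer_group)"
proof -
  let ?PG = "product_group {..<m} (\<lambda>_. integer_group)"
  define \<psi> where "\<psi> f = finprod G (\<lambda>j. b j [^] (f j :: int)) {..<m}" for f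
  have one: "\<Phi> \<one> = 0" using add[of \<one> \<one>] by simp
  have inv: "\<Phi> (inv x) = - \<Phi> x" if "x \<in> carrier G" for x
    using add[of "inv x" x] that one by (simp add: eq_neg_iff_add_eq_0)
  have npow: "\<Phi> (x [^] n) = real n *\<^sub>R \<Phi> x" if "x \<in> carrier G" for x and n :: nat
    by (induction n) (simp_all add: one add that scaleR_left_distrib)
  have ipow: "\<Phi> (x [^] n) = real_of_int n *\<^sub>R \<Phi> x" if "x \<in> carrier G" for x and n :: int
    by (cases n rule: int_cases2) (simp_all add: int_pow_int int_pow_neg_int npow inv that)
  have cl: "\<psi> f \<in> carrier G" for f using b unfolding \<psi>_def by (intro finprod_closed) auto
  have \<Phi>\<psi>: "\<Phi> (\<psi> f) = (\<Sum>j<m. real_of_int (f j) *\<^sub>R v j)" for f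
  proof -
    have "\<Phi> (finprod G (\<lambda>j. b j [^] f j) J) = (\<Sum>j\<in>J. real_of_int (f j) *\<^sub>R v j)"
      if "finite J" "J \<subseteq> {..<m}" for J
      using that
    proof (induction J rule: finite_induct)
      case (insert k J)
      have c: "b k [^] f k \<in> carrier G" "(\<lambda>j. b j [^] f j) \<in> J \<rightarrow> carrier G" using insert.prems b by auto
      then have "finprod G (\<lambda>j. b j [^] f j) J \<in> carrier G" by (intro finprod_closed)
      then show ?case using insert c b by (simp add: add ipow)
    qed (simp add: one)
    then show ?thesis by (simp add: \<psi>_def)
  qed
  have hom: "\<psi> \<in> hom ?PG G"
  proof (rule homI)
    fix f g assume "f \<in> carrier ?PG" "g \<in> carrier ?PG"
    have "\<psi> (f \<otimes>\<^bsub>?PG\<^esub> g) = finprod G (\<lambda>j. b j [^] f j \<otimes> b j [^] g j) {..<m}"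
      unfolding \<psi>_def using b by (intro finprod_cong') (auto simp: int_pow_mult)
    also have "\<dots> = \<psi> f \<otimes> \<psi> g" unfolding \<psi>_def using b by (intro finprod_multf) auto
    finally show "\<psi> (f \<otimes>\<^bsub>?PG\<^esub> g) = \<psi> f \<otimes> \<psi> g" .
  qed (rule cl)
  have PG: "group ?PG" by simp
  interpret h: group_hom ?PG G \<psi>
    using hom PG group_axioms by (simp add: group_hom_def group_hom_axioms_def)
  define B where "B = \<psi> ` carrier ?PG"
  have sB: "subgroup B G" unfolding B_def by (rule h.img_is_subgroup)
  have inj: "inj_on \<psi> (carrier ?PG)"
  proof (rule inj_onI)
    fix f g assume fg: "f \<in> carrier ?PG" "g \<in> carrier ?PG" "\<psi> f = \<psi> g"
    then have "(\<Sum>j<m. real_of_int (f j - g j) *\<^sub>R v j) = 0"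
      using \<Phi>\<psi>[of f] \<Phi>\<psi>[of g] by (simp add: scaleR_left_diff_distrib sum_subtractf)
    \<comment> \<open>Moves the coefficients from the indices j to the vectors v j, where
      independence applies.\<close>
    moreover define c where "c u = real_of_int (f (inv_into {..<m} v u) - g (inv_into {..<m} v u))" for u
    have cv: "c (v j) = real_of_int (f j - g j)" if "j < m" for j using that v(1) by (simp add: c_def)
    ultimately have "(\<Sum>u\<in>v ` {..<m}. c u *\<^sub>R u) = 0" using v(1) by (simp add: sum.reindex)
    then have "c u = 0" if "u \<in> v ` {..<m}" for u
      by (intro independentD[OF v(2) _ subset_refl _ that]) auto
    then have "f j = g j" if "j < m" for j using cv[OF that] that by simp
    then show "f = g" using fg by (intro PiE_ext) auto
  qed
  have "\<psi> \<in> iso ?PG (G\<lparr>carrier := B\<rparr>)"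
    using inj hom unfolding iso_iff by (auto simp: hom_def B_def)
  then have "G\<lparr>carrier := B\<rparr> \<cong> ?PG" using group.iso_sym[OF PG] by (auto simp: is_iso_def)
  moreover
  let ?X = "{x \<in> carrier G. \<exists>r. (\<forall>j<m. 0 \<le> r j \<and> r j \<le> (1::real)) \<and> \<Phi> x = (\<Sum>j<m. r j *\<^sub>R v j)}"
  have "{B #> a | a. a \<in> carrier G} \<subseteq> (\<lambda>x. B #> x) ` ?X"
  proof clarify
    fix x assume x: "x \<in> carrier G"
    obtain q where "\<Phi> x = (\<Sum>u\<in>v ` {..<m}. q u *\<^sub>R u)"
      using sp[OF x] span_finite[of "v ` {..<m}"] by auto
    then have q: "\<Phi> x = (\<Sum>j<m. q (v j) *\<^sub>R v j)" using v(1) by (simp add: sum.reindex)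
    \<comment> \<open>After removing these integer parts the coordinates are fractional parts, which
      lie in the unit interval.\<close>
    define f where "f = (\<lambda>j\<in>{..<m}. \<lfloor>q (v j)\<rfloor>)"
    define p where "p = \<psi> f"
    have p: "p \<in> carrier G" "p \<in> B" by (auto simp: p_def cl B_def f_def)
    define y where "y = inv p \<otimes> x"
    have y: "y \<in> carrier G" using p x by (simp add: y_def)
    have "\<Phi> y = (\<Sum>j<m. frac (q (v j)) *\<^sub>R v j)"
      using p x by (simp add: y_def add inv p_def \<Phi>\<psi> q f_def frac_def scaleR_left_diff_distrib sum_subtractf)
    then have "y \<in> ?X" using y by (auto intro!: exI[of _ "\<lambda>j. frac (q (v j))"] less_imp_le[OF frac_lt_1])
    moreover have "x = p \<otimes> y" using p x by (simp add: y_def flip: m_assoc)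
    then have "B #> x = B #> y"
      using coset_mult_assoc[OF subgroup.subset[OF sB] p(1) y] coset_join2[OF p(1) sB p(2)] by simp
    ultimately show "B #> x \<in> (\<lambda>x. B #> x) ` ?X" by blast
  qed
  then have "finite {B #> a | a. a \<in> carrier G}" using fin finite_subset by blast
  ultimately show thesis using that sB by blast
qed

section \<open>Vertices and translations of the simplex\<close>

lemma orthant_closure:
  fixes M :: "real^'n^'n"
  assumes "\<And>i. i \<in> I \<Longrightarrow> 0 \<le> x $ i" "\<And>i. i \<notin> I \<Longrightarrow> x $ i = 0"
  shows "M *v x \<in> closure ((*v) M ` open_orthant I)"
proof -
  define u :: "real^'n" where "u = (\<chi> i. if i \<in> I then 1 else 0)"
  define s where "s n = M *v (x + (1 / real (Suc n)) *\<^sub>R u)" for n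
  have "s n \<in> (*v) M ` open_orthant I" for n
    unfolding s_def using assms by (intro imageI) (auto simp: open_orthant_def u_def intro: add_nonneg_pos)
  moreover have "s \<longlonglongrightarrow> M *v (x + 0 *\<^sub>R u)"
    unfolding s_def
    by (intro isCont_tendsto_compose[OF matrix_vector_mult_linear_continuous_at] tendsto_intros LIMSEQ_Suc lim_1_over_n)
  ultimately show ?thesis unfolding closure_sequential by (intro exI[of _ s]) simp
qed

lemma convex_open_orthant: "convex (open_orthant I)"
  by (auto simp: convex_def open_orthant_def) (smt (verit) mult_nonneg_nonneg mult_pos_pos)

context projective_cone begin

text \<open>Since \<open>simplex_vertices\<close> ranges over all representations of S, the vertices
  must be recognized intrinsically. After a choice of sign the matrix maps the orthant onto Z; a
  vertex ray scaled to height 1 is then an extreme point of the slice of \<open>closure Z\<close>,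
  and \<open>extreme_point_eigenvector\<close> applies.\<close>

lemma vertex_class_fixed:
  fixes M :: "real^'n^'n"
  assumes Z: "minimal_subcone P Z" and P: "P \<subseteq> Aut_Q"
    and comm: "\<And>M N. M \<in> P \<Longrightarrow> N \<in> P \<Longrightarrow> M ** N = N ** M"
    and rep: "simplex_rep (proj_class ` Z) M I" and i: "i \<in> I" and a: "a \<in> P"
  shows "proj_class (a *v (M *v axis i 1)) = proj_class (M *v axis i 1)"
proof -
  have iZ: "invariant_subcone P Z" using Z by (simp add: minimal_subcone_def)
  note cl = closure_subcone[OF iZ]
  have ZQ: "Z \<subseteq> Q" and Zsc: "\<And>c x. 0 < c \<Longrightarrow> x \<in> Z \<Longrightarrow> c *\<^sub>R x \<in> Z"
    using iZ by (auto simp: invariant_subcone_def)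
  have M: "invertible M" and S: "proj_class ` Z = proj_class ` (*v) M ` open_orthant I"
    using rep by (auto simp: simplex_rep_def open_orthant_def image_def)
  have mem: "v \<in> Z \<or> - v \<in> Z" if v: "v \<in> (*v) M ` open_orthant I" for v
  proof -
    have "proj_class v \<in> proj_class ` Z" using v S by blast
    then obtain z where z: "z \<in> Z" "proj_class v = proj_class z" by blast
    obtain c where c: "c \<noteq> 0" "v = c *\<^sub>R z" using z(2) by (rule proj_class_eqD)
    then show ?thesis using Zsc[of c z] Zsc[of "- c" z] z(1) by (cases "0 < c") auto
  qed
  have "(*v) M ` open_orthant I \<subseteq> Q \<or> uminus ` (*v) M ` open_orthant I \<subseteq> Q"
    using mem ZQ by (intro one_sided convex_linear_image matrix_vector_mul_linear convex_open_orthant) blast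
  then obtain N where N: "N = M \<or> N = - M" "(*v) N ` open_orthant I \<subseteq> Q"
    using scaleR_matrix_vector'[of "-1" M] by (metis (no_types, lifting) image_cong image_image scaleR_minus1_left)
  have mv: "(- M) *v x = - (M *v x)" for x using scaleR_matrix_vector'[of "-1" M x] by simp
  have "(- M) ** (- matrix_inv M) = mat 1"
    using scaleR_matrix_mult[of "-1" M "-1" "matrix_inv M"] M by simp
  then have "invertible (- M)" using invertible_right_inverse by blast
  then have iN: "invertible N" using M N(1) by blast
  have cN: "proj_class (N *v x) = proj_class (M *v x)" for x
    using N(1) mv proj_class_minus by metis
  have NZ: "(*v) N ` open_orthant I = Z"
  proof
    show "(*v) N ` open_orthant I \<subseteq> Z"
    proof
      fix v assume v: "v \<in> (*v) N ` open_orthant I"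
      then obtain x where x: "x \<in> open_orthant I" "v = N *v x" by blast
      have "v \<in> Z \<or> - v \<in> Z" using mem[of "M *v x"] x N(1) mv by auto
      moreover have "v \<in> Q" using v N by blast
      then have "0 < w \<bullet> v" by (rule pos_Q)
      then have "- v \<notin> Z" using ZQ pos_Q[of "- v"] by auto
      ultimately show "v \<in> Z" by blast
    qed
    show "Z \<subseteq> (*v) N ` open_orthant I"
    proof
      fix z assume z: "z \<in> Z"
      then have "proj_class z \<in> proj_class ` (*v) M ` open_orthant I" using S by blast
      then obtain x where x: "x \<in> open_orthant I" "proj_class z = proj_class (N *v x)" using cN by auto
      have "N *v x \<in> Q" "z \<in> Q" using x N(2) z ZQ by auto
      then obtain c where c: "0 < c" "z = c *\<^sub>R (N *v x)" using Q_proj_class_eq x(2) by blast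
      then have "z = N *v (c *\<^sub>R x)" by (simp add: matrix_vector_mult_scaleR)
      moreover have "c *\<^sub>R x \<in> open_orthant I" using x(1) c(1) by (auto simp: open_orthant_def)
      ultimately show "z \<in> (*v) N ` open_orthant I" by blast
    qed
  qed
  define h where "h = N *v axis i 1"
  have hZ: "h \<in> closure Z" unfolding h_def NZ[symmetric]
    using i by (intro orthant_closure) (auto simp: axis_def)
  have h0: "h \<noteq> 0"
  proof
    assume "h = 0"
    then have "matrix_inv N *v h = 0" by simp
    then show False using iN by (simp add: h_def)
  qed
  have wh: "0 < w \<bullet> h" using hZ h0 cl(1) closure_pos by blast
  have cont: "continuous_on UNIV (\<lambda>v. (matrix_inv N *v v) $ j)" for j
    by (intro continuous_intros matrix_vector_mult_linear_continuous_on)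
  have coord: "0 \<le> (matrix_inv N *v z) $ j" if z: "z \<in> closure Z" for z j
  proof -
    have "closure Z \<subseteq> {z. 0 \<le> (matrix_inv N *v z) $ j}"
    proof (rule closure_minimal)
      show "Z \<subseteq> {z. 0 \<le> (matrix_inv N *v z) $ j}"
        using iN by (auto simp flip: NZ simp: open_orthant_def) (metis less_imp_le order_refl)
      show "closed {z. 0 \<le> (matrix_inv N *v z) $ j}"
        by (intro closed_Collect_le continuous_on_const cont)
    qed
    then show ?thesis using z by blast
  qed
  define e where "e = (1 / (w \<bullet> h)) *\<^sub>R h"
  have "e extreme_point_of {v \<in> closure Z. w \<bullet> v = 1}"
    unfolding extreme_point_of_def
  proof (intro conjI ballI)
    show "e \<in> {v \<in> closure Z. w \<bullet> v = 1}" using wh hZ cl(4) by (simp add: e_def)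
    fix p q assume p: "p \<in> {v \<in> closure Z. w \<bullet> v = 1}" and q: "q \<in> {v \<in> closure Z. w \<bullet> v = 1}"
    show "e \<notin> open_segment p q"
    proof
      assume "e \<in> open_segment p q"
      then obtain t where t: "p \<noteq> q" "0 < t" "t < 1" "e = (1 - t) *\<^sub>R p + t *\<^sub>R q"
        by (auto simp: in_segment)
      have ze: "(matrix_inv N *v e) $ j = 0" if "j \<noteq> i" for j
        using iN that by (simp add: e_def h_def matrix_vector_mult_scaleR axis_def)
      \<comment> \<open>A strictly positive combination of nonnegative numbers vanishes only if each
        does. So p and q lie on the line of h, which has a single point of height 1.\<close>
      have zpq: "(matrix_inv N *v p) $ j = 0 \<and> (matrix_inv N *v q) $ j = 0" if "j \<noteq> i" for j
      proof -
        have "(1 - t) * (matrix_inv N *v p) $ j + t * (matrix_inv N *v q) $ j = 0"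
          using ze[OF that] by (simp add: t(4) matrix_vector_right_distrib matrix_vector_mult_scaleR)
        moreover have "0 \<le> (matrix_inv N *v p) $ j" "0 \<le> (matrix_inv N *v q) $ j"
          using coord p q by auto
        ultimately show ?thesis using t(2,3)
          by (smt (verit) mult_nonneg_nonneg mult_pos_pos)
      qed
      have "z = h /\<^sub>R (w \<bullet> h)"
        if z: "w \<bullet> z = 1" "\<And>j. j \<noteq> i \<Longrightarrow> (matrix_inv N *v z) $ j = 0" for z
      proof -
        let ?c = "(matrix_inv N *v z) $ i"
        have "matrix_inv N *v z = ?c *\<^sub>R axis i 1"
          using z(2) by (auto simp: vec_eq_iff axis_def)
        then have "N *v (matrix_inv N *v z) = ?c *\<^sub>R h"
          by (metis h_def matrix_vector_mult_scaleR)
        then have zc: "z = ?c *\<^sub>R h" using iN by simp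
        then have "?c * (w \<bullet> h) = 1" using z(1) by (metis inner_scaleR_right)
        then have "?c = inverse (w \<bullet> h)" using wh by (simp add: field_simps)
        then show ?thesis using zc by simp
      qed
      from this[of p] this[of q] have "p = q" using p q zpq by simp
      then show False using t(1) by blast
    qed
  qed
  then obtain c where c: "0 < c" "a *v e = c *\<^sub>R e"
    using extreme_point_eigenvector[OF Z P comm a] by blast
  have "h = (w \<bullet> h) *\<^sub>R e" using wh by (simp add: e_def)
  then have "a *v h = c *\<^sub>R h" using c(2) by (metis matrix_vector_mult_scaleR scaleR_left_commute)
  then have "proj_class (a *v h) = proj_class h" using c(1) by (simp add: proj_class_scale)
  moreover have "a *v h = a *v (M *v axis i 1) \<or> a *v h = - (a *v (M *v axis i 1))"
    using N(1) mv matrix_vector_mult_scaleR[of a "-1"] by (auto simp: h_def)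
  then have "proj_class (a *v h) = proj_class (a *v (M *v axis i 1))"
    using proj_class_minus by metis
  ultimately show ?thesis using cN by (simp add: h_def)
qed

lemma diagonal_action:
  fixes M :: "real^'n^'n"
  assumes "\<And>i. i \<in> I \<Longrightarrow> \<exists>c>0. a *v (M *v axis i 1) = c *\<^sub>R (M *v axis i 1)"
  obtains ev where "\<And>i. 0 < ev i"
    "\<And>x. x \<in> open_orthant I \<Longrightarrow> a *v (M *v x) = M *v (\<chi> i. ev i * x $ i)"
proof -
  obtain c where c: "\<And>i. i \<in> I \<Longrightarrow> 0 < c i \<and> a *v (M *v axis i 1) = c i *\<^sub>R (M *v axis i 1)"
    using assms by metis
  \<comment> \<open>Coordinates outside I vanish on the orthant, so the default there only has to be
    positive.\<close>
  define ev where "ev i = (if i \<in> I then c i else 1)" for i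
  have "a *v (M *v x) = M *v (\<chi> i. ev i * x $ i)" if x: "x \<in> open_orthant I" for x
  proof -
    have "a *v (M *v x) = a *v (\<Sum>i\<in>UNIV. (x $ i) *\<^sub>R (M *v axis i 1))"
      by (subst matrix_vector_sum_axis) simp
    also have "\<dots> = (\<Sum>i\<in>UNIV. (x $ i) *\<^sub>R (a *v (M *v axis i 1)))"
      by (simp add: linear_sum[OF matrix_vector_mul_linear] matrix_vector_mult_scaleR)
    also have "\<dots> = (\<Sum>i\<in>UNIV. (ev i * x $ i) *\<^sub>R (M *v axis i 1))"
      using c x by (intro sum.cong) (auto simp: ev_def open_orthant_def)
    finally show ?thesis by (subst (2) matrix_vector_sum_axis) simp
  qed
  then show thesis using that[of ev] c by (simp add: ev_def)
qed

text \<open>Logarithms of coordinate ratios turn the simplex into a vector space of dimension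
  \<open>card I - 1\<close> on which A acts by translations. Co-compactness makes the translations
  span this space, and discreteness leaves finitely many elements of A with translation of bounded
  norm.\<close>

lemma simplex_lattice:
  fixes M :: "real^'n^'n"
  assumes \<Lambda>: "discrete_subgroup \<Lambda>" and A: "subgroup A pgl_group" "A \<subseteq> \<Lambda>"
    and abelian: "\<And>a b. a \<in> A \<Longrightarrow> b \<in> A \<Longrightarrow> a \<otimes>\<^bsub>pgl_group\<^esub> b = b \<otimes>\<^bsub>pgl_group\<^esub> a"
    and lift: "\<And>a. a \<in> A \<Longrightarrow> \<exists>L\<in>lifts A. a = proj_class L"
    and M: "invertible M" and I: "I \<noteq> {}" and Z: "Z = (*v) M ` open_orthant I" and ZQ: "Z \<subseteq> Q"
    and eig: "\<And>a i. a \<in> lifts A \<Longrightarrow> i \<in> I \<Longrightarrow> \<exists>c>0. a *v (M *v axis i 1) = c *\<^sub>R (M *v axis i 1)"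
    and K: "compact K" "K \<subseteq> Z" and coc: "\<And>z. z \<in> Z \<Longrightarrow> \<exists>a\<in>lifts A. a *v z \<in> K"
  shows "\<exists>B. subgroup B pgl_group \<and> B \<subseteq> A \<and> finite {r_coset pgl_group B a | a. a \<in> A} \<and>
    pgl_group\<lparr>carrier := B\<rparr> \<cong> product_group {..<card I - 1} (\<lambda>_. integer_group)"
proof -
  define N where "N = matrix_inv M"
  have NM: "N *v (M *v x) = x" for x using M by (simp add: N_def)
  obtain i0 where i0: "i0 \<in> I" using I by blast
  define J where "J = I - {i0}"
  \<comment> \<open>Ratios to the coordinate at i0 make \<psi> invariant under positive scaling; the
    value 0 outside J confines it to the coordinate subspace of J.\<close>
  define \<psi> :: "real^'n \<Rightarrow> real^'n" where
    "\<psi> v = (\<chi> i. if i \<in> J then ln ((N *v v) $ i) - ln ((N *v v) $ i0) else 0)" for v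
  define u :: "real^'n" where "u = (\<chi> i. if i \<in> I then 1 else 0)"
  define p where "p = M *v u"
  have u: "u \<in> open_orthant I" by (auto simp: u_def open_orthant_def)
  then have pZ: "p \<in> Z" by (auto simp: Z p_def)
  define \<phi> where "\<phi> a = \<psi> (a *v p)" for a
  have scale: "\<psi> (c *\<^sub>R v) = \<psi> v" if c: "0 < c" and v: "v \<in> Z" for c v
  proof -
    obtain x where x: "x \<in> open_orthant I" "v = M *v x" using v Z by blast
    have xp: "0 < x $ i" if "i \<in> I" for i using x(1) that by (simp add: open_orthant_def)
    have "\<psi> (c *\<^sub>R v) $ i = \<psi> v $ i" for i
      using xp[of i] xp[of i0] c i0 unfolding \<psi>_def x(2)
      by (cases "i \<in> J") (simp_all add: matrix_vector_mult_scaleR NM ln_mult J_def)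
    then show ?thesis by (simp add: vec_eq_iff)
  qed
  have inv: "a *v z \<in> Z" if a: "a \<in> lifts A" and z: "z \<in> Z" for a z
  proof -
    obtain ev where ev: "\<And>i. 0 < ev i" "\<And>x. x \<in> open_orthant I \<Longrightarrow> a *v (M *v x) = M *v (\<chi> i. ev i * x $ i)"
      using diagonal_action[OF eig[OF a]] by blast
    obtain x where x: "x \<in> open_orthant I" "z = M *v x" using z Z by blast
    have "(\<chi> i. ev i * x $ i) \<in> open_orthant I" using x ev(1) by (auto simp: open_orthant_def)
    then show ?thesis using ev(2)[OF x(1)] x(2) Z by auto
  qed
  have equiv: "\<psi> (a *v v) = \<psi> v + \<phi> a" if a: "a \<in> lifts A" and v: "v \<in> Z" for a v
  proof -
    obtain ev where ev: "\<And>i. 0 < ev i" "\<And>x. x \<in> open_orthant I \<Longrightarrow> a *v (M *v x) = M *v (\<chi> i. ev i * x $ i)"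
      using diagonal_action[OF eig[OF a]] by blast
    obtain x where x: "x \<in> open_orthant I" "v = M *v x" using v Z by blast
    have xp: "0 < x $ i" if "i \<in> I" for i using x that by (simp add: open_orthant_def)
    have "\<psi> (a *v v) $ i = \<psi> v $ i + \<phi> a $ i" for i
      using ev(1)[of i] ev(1)[of i0] xp[of i] xp[of i0] i0
      unfolding \<phi>_def p_def \<psi>_def x(2) ev(2)[OF x(1)] ev(2)[OF u]
      by (cases "i \<in> J") (simp_all add: NM ln_mult u_def J_def)
    then show ?thesis by (simp add: vec_eq_iff)
  qed
  have \<phi>_mult: "\<phi> (a ** b) = \<phi> a + \<phi> b" if "a \<in> lifts A" "b \<in> lifts A" for a b
    using equiv[OF that(1) inv[OF that(2) pZ]]
    unfolding \<phi>_def by (simp add: add.commute flip: matrix_vector_mul_assoc)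
  \<comment> \<open>Lifts of one class differ by a positive factor, which \<phi> ignores, so any
    choice of lift gives the same value.\<close>
  define \<Phi> where "\<Phi> g = \<phi> (SOME L. L \<in> lifts A \<and> proj_class L = g)" for g
  have \<Phi>: "\<Phi> (proj_class L) = \<phi> L" if L: "L \<in> lifts A" for L
  proof -
    define L' where "L' = (SOME L'. L' \<in> lifts A \<and> proj_class L' = proj_class L)"
    have L': "L' \<in> lifts A \<and> proj_class L' = proj_class L"
      unfolding L'_def by (rule someI[of _ L]) (simp add: L)
    obtain c where c: "0 < c" "L' = c *\<^sub>R L"
      using Aut_Q_proj_class_eq[of L' L] L L' lifts_Aut by blast
    then have "\<phi> L' = \<phi> L" using scale[OF c(1) inv[OF L pZ]] by (simp add: \<phi>_def scaleR_matrix_vector')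
    then show ?thesis by (simp add: \<Phi>_def L'_def)
  qed
  define T :: "(real^'n) set" where "T = {x. \<forall>i. i \<notin> J \<longrightarrow> x $ i = 0}"
  have subT: "subspace T" by (auto simp: subspace_def T_def)
  have dimT: "dim T = card I - 1"
    using dim_substandard_cart[of J, where ?'a = real] i0 by (simp add: dim_vec_eq T_def J_def)
  have \<phi>T: "\<phi> a \<in> T" for a by (simp add: T_def \<phi>_def \<psi>_def)
  \<comment> \<open>If some nonzero y in T were orthogonal to all translations, the pairing of y
    with \<psi> would be invariant under A and so bounded by its values on K, although \<psi>
    attains every multiple of y.\<close>
  have spanT: "span (\<phi> ` lifts A) = T"
  proof (rule ccontr)
    assume ne: "span (\<phi> ` lifts A) \<noteq> T"
    have "span (\<phi> ` lifts A) \<subseteq> T" using \<phi>T subT by (intro span_minimal) auto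
    moreover have spT: "span T = T" using subT span_eq_iff by blast
    ultimately have "span (\<phi> ` lifts A) \<subset> span T" using ne by blast
    then obtain y where y: "y \<noteq> 0" "y \<in> span T" "\<And>x. x \<in> span (\<phi> ` lifts A) \<Longrightarrow> orthogonal y x"
      by (rule orthogonal_to_subspace_exists_gen) blast
    have yT: "y \<in> T" using y(2) spT by blast
    have orth: "y \<bullet> \<phi> a = 0" if "a \<in> lifts A" for a
      using y(3)[OF span_base[OF imageI[OF that]]] by (simp add: orthogonal_def)
    have pos: "0 < (N *v v) $ i" if "v \<in> Z" "i \<in> I" for v i
      using that by (auto simp: Z NM open_orthant_def)
    have "continuous_on K (\<lambda>v. (N *v v) $ i)" for i
      by (intro continuous_intros matrix_vector_mult_linear_continuous_on)
    moreover have "(N *v v) $ i \<noteq> 0" if "v \<in> K" "i \<in> I" for v i using pos[of v i] that K(2) by force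
    ultimately have "continuous_on K (\<lambda>v. \<Sum>i\<in>J. y $ i * (ln ((N *v v) $ i) - ln ((N *v v) $ i0)))"
      using i0 by (intro continuous_intros) (auto simp: J_def)
    moreover have "y \<bullet> \<psi> v = (\<Sum>i\<in>J. y $ i * (ln ((N *v v) $ i) - ln ((N *v v) $ i0)))" for v
      unfolding inner_vec_def \<psi>_def by (simp add: if_distrib sum.If_cases cong: if_cong)
    ultimately have "continuous_on K (\<lambda>v. y \<bullet> \<psi> v)" by simp
    then have "bounded ((\<lambda>v. y \<bullet> \<psi> v) ` K)" using K(1) compact_continuous_image compact_imp_bounded by blast
    then obtain R where R: "\<And>v. v \<in> K \<Longrightarrow> norm (y \<bullet> \<psi> v) \<le> R" by (auto simp: bounded_iff)
    have R': "\<bar>y \<bullet> \<psi> v\<bar> \<le> R" if v: "v \<in> Z" for v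
    proof -
      obtain a where a: "a \<in> lifts A" "a *v v \<in> K" using coc[OF v] by blast
      have "y \<bullet> \<psi> (a *v v) = y \<bullet> \<psi> v" using equiv[OF a(1) v] orth[OF a(1)] by (simp add: inner_add_right)
      then show ?thesis using R[OF a(2)] by simp
    qed
    \<comment> \<open>Chosen so that the pairing of y with s y is R + 1, beyond the bound R.\<close>
    define s where "s = (R + 1) / (y \<bullet> y)"
    define x :: "real^'n" where "x = (\<chi> i. if i \<in> I then exp (s * y $ i) else 0)"
    have "x \<in> open_orthant I" by (auto simp: x_def open_orthant_def)
    then have "M *v x \<in> Z" using Z by blast
    moreover have "\<psi> (M *v x) = s *\<^sub>R y"
      using yT i0 by (auto simp: \<psi>_def vec_eq_iff NM x_def T_def J_def)
    ultimately have "\<bar>s * (y \<bullet> y)\<bar> \<le> R" using R'[of "M *v x"] by simp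
    moreover have "s * (y \<bullet> y) = R + 1" using y(1) by (simp add: s_def)
    ultimately show False by simp
  qed
  obtain E where E: "E \<subseteq> \<phi> ` lifts A" "independent E" "\<phi> ` lifts A \<subseteq> span E"
    using maximal_independent_subset by blast
  define m where "m = card I - 1"
  have spE: "span E = T"
    using E(1,3) spanT span_mono span_span by (metis subset_antisym)
  have "card E = m" using dim_eq_card[OF spE[unfolded spanT[symmetric]] E(2)] dim_span[of "\<phi> ` lifts A"] spanT dimT
    by (metis m_def)
  moreover have "finite E" using E(2) independent_imp_finite by blast
  ultimately obtain v where v: "bij_betw v {..<m} E"
    using ex_bij_betw_nat_finite[of E] by (auto simp: lessThan_atLeast0)
  have "\<forall>j<m. \<exists>L. L \<in> lifts A \<and> \<phi> L = v j"
  proof (intro allI impI)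
    fix j assume "j < m"
    then have "v j \<in> \<phi> ` lifts A" using E(1) bij_betwE[OF v] by blast
    then show "\<exists>L. L \<in> lifts A \<and> \<phi> L = v j" by force
  qed
  then obtain L where L: "\<And>j. j < m \<Longrightarrow> L j \<in> lifts A \<and> \<phi> (L j) = v j" by metis
  let ?GA = "pgl_group\<lparr>carrier := A\<rparr>"
  interpret G: group "pgl_group :: (real^'n^'n) set monoid" by (rule group_pgl)
  interpret GA: comm_group ?GA
    using abelian by (intro group.group_comm_groupI G.subgroup_imp_group A) auto
  \<comment> \<open>Bounds the norm on the parallelepiped spanned by the v j with coefficients in
    [0, 1].\<close>
  define R where "R = (\<Sum>j<m. norm (v j))"
  have fin: "finite {x \<in> A. norm (\<Phi> x) \<le> R}"
  proof -
    obtain \<delta> where \<delta>: "0 < \<delta>" "\<And>M N. M \<in> lifts \<Lambda> \<Longrightarrow> N \<in> lifts \<Lambda> \<Longrightarrow>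
        norm (M ** matrix_inv N - mat 1) < \<delta> \<Longrightarrow> proj_class M = proj_class N"
      using lifts_discrete[OF \<Lambda>] by blast
    \<comment> \<open>The base point p serves as the compact set: a translation of norm at most R
      has a lift whose coordinates at p lie between exp (-R) and exp R times those of p.\<close>
    let ?X = "{proj_class M | M. M \<in> lifts \<Lambda> \<and>
      (\<exists>x\<in>{p}. M *v x - exp (- R) *\<^sub>R x \<in> closure Q \<and> exp R *\<^sub>R x - M *v x \<in> closure Q)}"
    have "finite ?X"
      using pZ ZQ \<delta> lifts_Aut by (intro finite_bounded_displacement[where \<delta> = \<delta>]) auto
    moreover have "{x \<in> A. norm (\<Phi> x) \<le> R} \<subseteq> ?X"
    proof clarify
      fix x assume x: "x \<in> A" "norm (\<Phi> x) \<le> R"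
      obtain a where a: "a \<in> lifts A" "x = proj_class a" using lift[OF x(1)] by blast
      have na: "\<bar>\<phi> a $ i\<bar> \<le> R" for i
        using x(2) \<Phi>[OF a(1)] component_le_norm_cart[of "\<phi> a" i] a(2) by simp
      obtain ev where ev: "\<And>i. 0 < ev i" "\<And>x. x \<in> open_orthant I \<Longrightarrow> a *v (M *v x) = M *v (\<chi> i. ev i * x $ i)"
        using diagonal_action[OF eig[OF a(1)]] by blast
      \<comment> \<open>Rescale the lift so that its eigenvalue at the reference vertex \<open>i0\<close> is \<open>1\<close>.\<close>
      define a' where "a' = (1 / ev i0) *\<^sub>R a"
      have a': "a' \<in> lifts A" "proj_class a' = x"
        using ev(1)[of i0] a by (auto simp: a'_def proj_class_scale intro: lifts_scale)
      \<comment> \<open>For i = i0 both sides are 1, because \<phi> vanishes at that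
        coordinate.\<close>
      have \<phi>i: "exp (\<phi> a $ i) = ev i / ev i0" if "i \<in> I" for i
        using that i0 ev(1)[of i] ev(1)[of i0] unfolding \<phi>_def p_def \<psi>_def ev(2)[OF u]
        by (auto simp: NM u_def J_def exp_diff)
      have a'p: "a' *v p = M *v (\<chi> i. (ev i / ev i0) * u $ i)"
        unfolding a'_def p_def scaleR_matrix_vector' ev(2)[OF u] matrix_vector_mult_scaleR[symmetric]
        by (rule arg_cong[where f = "(*v) M"]) (simp add: vec_eq_iff)
      have "closure Z \<subseteq> closure Q" using ZQ by (rule closure_mono)
      moreover have "M *v ((\<chi> i. (ev i / ev i0) * u $ i) - exp (- R) *\<^sub>R u) \<in> closure Z"
        unfolding Z
      proof (rule orthant_closure)
        fix i assume i: "i \<in> I"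
        have "exp (- R) \<le> exp (\<phi> a $ i)" using na[of i] by simp
        then show "0 \<le> ((\<chi> i. (ev i / ev i0) * u $ i) - exp (- R) *\<^sub>R u) $ i"
          using i by (simp add: u_def \<phi>i)
      qed (simp add: u_def)
      moreover have "M *v (exp R *\<^sub>R u - (\<chi> i. (ev i / ev i0) * u $ i)) \<in> closure Z"
        unfolding Z
      proof (rule orthant_closure)
        fix i assume i: "i \<in> I"
        have "exp (\<phi> a $ i) \<le> exp R" using na[of i] by simp
        then show "0 \<le> (exp R *\<^sub>R u - (\<chi> i. (ev i / ev i0) * u $ i)) $ i"
          using i by (simp add: u_def \<phi>i)
      qed (simp add: u_def)
      ultimately have "a' *v p - exp (- R) *\<^sub>R p \<in> closure Q" "exp R *\<^sub>R p - a' *v p \<in> closure Q"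
        unfolding a'p unfolding p_def by (auto simp: matrix_vector_mult_diff_distrib matrix_vector_mult_scaleR)
      moreover have "a' \<in> lifts \<Lambda>" using a'(1) A(2) by (auto simp: lifts_def)
      ultimately show "\<exists>M. x = proj_class M \<and> M \<in> lifts \<Lambda> \<and>
        (\<exists>x\<in>{p}. M *v x - exp (- R) *\<^sub>R x \<in> closure Q \<and> exp R *\<^sub>R x - M *v x \<in> closure Q)"
        using a'(2) by blast
    qed
    ultimately show ?thesis using finite_subset by blast
  qed
  obtain B where B: "subgroup B ?GA" "finite {r_coset ?GA B a | a. a \<in> carrier ?GA}"
    "?GA\<lparr>carrier := B\<rparr> \<cong> product_group {..<m} (\<lambda>_. integer_group)"
  proof (rule GA.finite_index_integer_lattice[where \<Phi> = \<Phi> and v = v and m = m and b = "\<lambda>j. proj_class (L j)"])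
    fix x y assume xy: "x \<in> carrier ?GA" "y \<in> carrier ?GA"
    obtain a where "a \<in> lifts A" "x = proj_class a" using lift[of x] xy by auto
    moreover obtain b where "b \<in> lifts A" "y = proj_class b" using lift[of y] xy by auto
    ultimately show "\<Phi> (x \<otimes>\<^bsub>?GA\<^esub> y) = \<Phi> x + \<Phi> y"
      using lifts_mult[OF A(1)] by (simp add: pgl_mult \<Phi> \<phi>_mult)
  next
    fix j assume "j < m"
    then show "proj_class (L j) \<in> carrier ?GA \<and> \<Phi> (proj_class (L j)) = v j"
      using L \<Phi> by (auto simp: lifts_def)
  next
    show "inj_on v {..<m}" "independent (v ` {..<m})" using v E(2) by (auto simp: bij_betw_def)
    fix x assume "x \<in> carrier ?GA"
    then obtain a where "a \<in> lifts A" "x = proj_class a" using lift[of x] by auto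
    then show "\<Phi> x \<in> span (v ` {..<m})" using \<Phi> E(3) v by (auto simp: bij_betw_def)
  next
    have "{x \<in> carrier ?GA. \<exists>r. (\<forall>j<m. 0 \<le> r j \<and> r j \<le> (1::real)) \<and> \<Phi> x = (\<Sum>j<m. r j *\<^sub>R v j)} \<subseteq> {x \<in> A. norm (\<Phi> x) \<le> R}"
    proof clarify
      fix x and r :: "nat \<Rightarrow> real"
      assume x: "x \<in> carrier ?GA" "\<forall>j<m. 0 \<le> r j \<and> r j \<le> 1" "\<Phi> x = (\<Sum>j<m. r j *\<^sub>R v j)"
      have "norm (\<Phi> x) \<le> (\<Sum>j<m. norm (r j *\<^sub>R v j))" unfolding x(3) by (rule norm_sum)
      also have "\<dots> \<le> R" unfolding R_def using x(2)
        by (intro sum_mono) (auto intro: mult_left_le_one_le)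
      finally show "x \<in> A \<and> norm (\<Phi> x) \<le> R" using x(1) by simp
    qed
    then show "finite {x \<in> carrier ?GA. \<exists>r. (\<forall>j<m. 0 \<le> r j \<and> r j \<le> (1::real)) \<and> \<Phi> x = (\<Sum>j<m. r j *\<^sub>R v j)}"
      using fin finite_subset by blast
  qed blast
  have "subgroup B pgl_group" by (rule G.incl_subgroup[OF A(1) B(1)])
  moreover have "B \<subseteq> A" using subgroup.subset[OF B(1)] by simp
  moreover have "finite {r_coset pgl_group B a | a. a \<in> A}" using B(2) by (simp add: r_coset_def)
  moreover have "pgl_group\<lparr>carrier := B\<rparr> \<cong> product_group {..<card I - 1} (\<lambda>_. integer_group)"
    using B(3) by (simp add: m_def)
  ultimately show ?thesis by blast
qed

end

section \<open>Proper embedding of the simplex and assembly of the theorem\<close>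

lemma closedin_properly_embedded:
  assumes "closedin (subtopology proj_top \<Omega>) S" "S \<subseteq> C" "C \<subseteq> \<Omega>"
  shows "properly_embedded S C"
proof -
  have "closedin (subtopology proj_top C) S"
    using assms unfolding closedin_subtopology by blast
  moreover have "subtopology proj_top S = subtopology (subtopology proj_top C) S"
    using assms(2) by (simp add: subtopology_subtopology Int_absorb1)
  ultimately have "closed_map (subtopology proj_top S) (subtopology proj_top C) (\<lambda>x. x)"
    unfolding closed_map_def by (auto intro: closedin_trans_full)
  \<comment> \<open>Fibres of an injective map have at most one point, so properness reduces to
    closedness of the map.\<close>
  then show ?thesis
    using assms(2) unfolding properly_embedded_def by (simp add: injective_imp_proper_eq_closed_map)
qed

theorem mainTheorem1:
  fixes \<Omega> \<C> :: "(real^'n) set set" and \<Lambda> A :: "(real^'n^'n) set set"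
  assumes "naive_cc_triple \<Omega> \<C> \<Lambda>"
    and "maximal_abelian_subgroup A \<Lambda>"
  shows "\<exists>S M I. simplex_rep S M I \<and> properly_embedded S \<C> \<and>
           (\<forall>a\<in>A. pgl_act a ` S = S) \<and>
           acts_cocompactly A S \<and>
           (\<forall>a\<in>A. \<forall>p\<in>simplex_vertices S. pgl_act a p = p) \<and>
           (\<exists>B. subgroup B pgl_group \<and> B \<subseteq> A \<and>
                finite {r_coset pgl_group B a | a. a \<in> A} \<and>
                pgl_group\<lparr>carrier := B\<rparr> \<cong> product_group {..<card I - 1} (\<lambda>_. integer_group))"
proof -
  have dom: "openin proj_top \<Omega>" and disc: "discrete_subgroup \<Lambda>"
    and GO: "\<And>g. g \<in> \<Lambda> \<Longrightarrow> pgl_act g ` \<Omega> = \<Omega>" and Cne: "\<C> \<noteq> {}" and CO: "\<C> \<subseteq> \<Omega>"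
    and Ccl: "closedin (subtopology proj_top \<Omega>) \<C>" and Ccv: "proj_convex_in \<Omega> \<C>"
    and GC: "\<And>g. g \<in> \<Lambda> \<Longrightarrow> pgl_act g ` \<C> = \<C>" and coc: "acts_cocompactly \<Lambda> \<C>"
    using assms(1) by (auto simp: naive_cc_triple_def properly_convex_domain_def)
  have sL: "subgroup \<Lambda> pgl_group" using disc by (simp add: discrete_subgroup_def)
  have sA: "subgroup A pgl_group" and AL: "A \<subseteq> \<Lambda>"
    and abel: "\<And>a b. a \<in> A \<Longrightarrow> b \<in> A \<Longrightarrow> a \<otimes>\<^bsub>pgl_group\<^esub> b = b \<otimes>\<^bsub>pgl_group\<^esub> a"
    using assms(2) by (auto simp: maximal_abelian_subgroup_def)
  \<comment> \<open>One chart serves for both sets: \<Omega> is bounded and convex in it and \<C> is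
    convex in it.\<close>
  obtain w where w: "in_chart_bounded_convex w \<Omega>" "convex (chart_lift w \<C>)"
    using Ccv by (auto simp: proj_convex_in_def)
  define Q where "Q = {v. 0 < w \<bullet> v \<and> proj_class v \<in> \<Omega>}"
  obtain \<kappa> where "projective_cone Q w \<kappa> \<Omega>"
    using projective_cone_exists[OF w(1) dom] Cne CO unfolding Q_def by blast
  then interpret projective_cone Q w \<kappa> \<Omega> .
  define C where "C = {v \<in> Q. proj_class v \<in> \<C>}"
  have scC: "c *\<^sub>R x \<in> C" if "0 < c" "x \<in> C" for c x
    using that by (simp add: C_def scale_Q proj_class_scale)
  have invC: "invariant_subcone (lifts \<Lambda>) C"
    unfolding invariant_subcone_def
  proof (intro conjI allI ballI impI)
    obtain q where "q \<in> \<C>" using Cne by blast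
    then obtain v where "v \<in> Q" "q = proj_class v" using \<Omega>_rep CO by blast
    then show "C \<noteq> {}" using \<open>q \<in> \<C>\<close> by (auto simp: C_def)
    show "C \<subseteq> Q" by (auto simp: C_def)
    show "convex C"
    proof -
      have "C = {v. 0 < w \<bullet> v \<and> proj_class v \<in> \<C>}" using CO by (auto simp: C_def Q_def)
      then show ?thesis using convex_chart_cone[OF w(2)] by simp
    qed
    show "c *\<^sub>R x \<in> C" if "0 < c" "x \<in> C" for c x using that by (rule scC)
    show "Q \<inter> closure C \<subseteq> C" unfolding C_def by (rule closedin_cone[OF Ccl])
    show "M *v x \<in> C" if "M \<in> lifts \<Lambda>" "x \<in> C" for M x
    proof -
      have "pgl_act (proj_class M) (proj_class x) \<in> \<C>"
        using that GC[of "proj_class M"] by (auto simp: lifts_def C_def)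
      then show ?thesis using that by (simp add: C_def pgl_act_proj_class lifts_def Aut_QD)
    qed
  qed
  obtain K where K: "compact K" "K \<subseteq> C" "\<And>v. v \<in> C \<Longrightarrow> \<exists>M\<in>lifts \<Lambda>. M *v v \<in> K"
  proof (rule cocompact_lift[OF sL GO CO Ccl coc])
    fix K assume "compact K" "K \<subseteq> {v \<in> Q. proj_class v \<in> \<C>}"
      "\<And>v. v \<in> Q \<Longrightarrow> proj_class v \<in> \<C> \<Longrightarrow> \<exists>M\<in>lifts \<Lambda>. M *v v \<in> K"
    then show thesis by (intro that[of K]) (auto simp: C_def)
  qed
  obtain Y K' where Y: "invariant_subcone (lifts A) Y" "Y \<subseteq> C" "compact K'" "K' \<subseteq> Y"
    "\<And>y. y \<in> Y \<Longrightarrow> \<exists>M\<in>lifts A. M *v y \<in> K'"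
  proof (rule maximal_abelian_cocompact_subcone[OF disc assms(2) GO invC K])
    fix Y K' assume "invariant_subcone (lifts A) Y" "Y \<subseteq> C" "compact K'" "K' \<subseteq> Y"
      "\<And>y. y \<in> Y \<Longrightarrow> \<exists>M\<in>lifts A. M *v y \<in> K'"
    then show thesis by (rule that)
  qed
  obtain Z where Z: "minimal_subcone (lifts A) Z" "Z \<subseteq> Y"
    by (rule exists_minimal_subcone[OF Y(1,3,4,5)])
  have iZ: "invariant_subcone (lifts A) Z" using Z by (simp add: minimal_subcone_def)
  have ZQ: "Z \<subseteq> Q" and Zcl: "Q \<inter> closure Z \<subseteq> Z" and Zsc: "\<And>c x. 0 < c \<Longrightarrow> x \<in> Z \<Longrightarrow> c *\<^sub>R x \<in> Z"
    and Zinv: "\<And>M x. M \<in> lifts A \<Longrightarrow> x \<in> Z \<Longrightarrow> M *v x \<in> Z"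
    using iZ by (auto simp: invariant_subcone_def)
  have lQ: "lifts A \<subseteq> Aut_Q" by (auto simp: lifts_def)
  have comm: "M ** N = N ** M" if "M \<in> lifts A" "N \<in> lifts A" for M N
    using lifts_commute_iff[of M N] that abel by (simp add: lifts_def)
  have lift: "\<exists>L\<in>lifts A. a = proj_class L" if a: "a \<in> A" for a
  proof -
    have "a \<in> pgl" "pgl_act a ` \<Omega> = \<Omega>"
      using a subgroup.subset[OF sA] GO AL by (auto simp: pgl_group_def)
    then obtain M where "M \<in> Aut_Q" "a = proj_class M" using lift_exists by blast
    then show ?thesis using a by (auto simp: lifts_def)
  qed
  obtain M :: "real^'n^'n" and I where M: "invertible M" "I \<noteq> {}" "Z = (*v) M ` open_orthant I"
    "\<And>a i. a \<in> lifts A \<Longrightarrow> i \<in> I \<Longrightarrow> \<exists>c>0. a *v (M *v axis i 1) = c *\<^sub>R (M *v axis i 1)"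
  proof (rule minimal_subcone_simplicial[OF Z(1) lQ comm])
    fix M :: "real^'n^'n" and I
    assume "invertible M" "I \<noteq> {}" "Z = (*v) M ` open_orthant I"
      "\<And>a i. a \<in> lifts A \<Longrightarrow> i \<in> I \<Longrightarrow> \<exists>c>0. a *v (M *v axis i 1) = c *\<^sub>R (M *v axis i 1)"
    then show thesis by (rule that)
  qed
  define S where "S = proj_class ` Z"
  have rep: "simplex_rep S M I"
    using M(1,2) by (auto simp: simplex_rep_def S_def M(3) open_orthant_def)
  have SC: "S \<subseteq> \<C>" using Z(2) Y(2) by (auto simp: S_def C_def)
  have emb: "properly_embedded S \<C>"
    using closedin_properly_embedded[OF _ SC CO] closedin_proj_class[OF ZQ Zcl Zsc] by (simp add: S_def)
  have actS: "pgl_act a s \<in> S" if a: "a \<in> A" and s: "s \<in> S" for a s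
  proof -
    obtain L where "L \<in> lifts A" "a = proj_class L" using lift[OF a] by blast
    then show ?thesis using s Zinv by (auto simp: S_def pgl_act_proj_class)
  qed
  have act_inv: "s = pgl_act (proj_class (matrix_inv L)) (pgl_act (proj_class L) s) \<and>
      s = pgl_act (proj_class L) (pgl_act (proj_class (matrix_inv L)) s)"
    if "L \<in> lifts A" "s \<in> S" for L s
    using that by (auto simp: S_def pgl_act_proj_class lifts_def Aut_Q_def)
  have invS: "pgl_act a ` S = S" if a: "a \<in> A" for a
  proof
    show "pgl_act a ` S \<subseteq> S" using actS a by blast
    show "S \<subseteq> pgl_act a ` S"
    proof
      fix s assume s: "s \<in> S"
      obtain L where L: "L \<in> lifts A" "a = proj_class L" using lift[OF a] by blast
      have "proj_class (matrix_inv L) \<in> A" using lifts_inv[OF sA L(1)] by (simp add: lifts_def)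
      then show "s \<in> pgl_act a ` S" using act_inv[OF L(1) s] actS s L(2) by blast
    qed
  qed
  \<comment> \<open>Lifts of A preserve Z, so a translate of a point of Z that reaches K' reaches
    the part of K' in Z.\<close>
  define K'' where "K'' = K' \<inter> closure Z"
  have K'Q: "K' \<subseteq> Q" using Y(1,4) by (auto simp: invariant_subcone_def)
  have K'': "compact K''" "K'' \<subseteq> Z" using Y(3) K'Q Zcl by (auto simp: K''_def)
  have cocZ: "\<exists>a\<in>lifts A. a *v z \<in> K''" if z: "z \<in> Z" for z
  proof -
    obtain a where a: "a \<in> lifts A" "a *v z \<in> K'" using Y(5) Z(2) z by blast
    then show ?thesis using Zinv[OF a(1) z] closure_subset by (auto simp: K''_def)
  qed
  have "acts_cocompactly A S"
    unfolding acts_cocompactly_def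
  proof (intro exI[of _ "proj_class ` K''"] conjI)
    show "proj_class ` K'' \<subseteq> S" using K''(2) by (auto simp: S_def)
    have "0 \<notin> K''" using K''(2) ZQ Q_nonzero by blast
    then show "compactin proj_top (proj_class ` K'')" by (rule compactin_proj_class[OF K''(1)])
    show "(\<Union>g\<in>A. pgl_act g ` proj_class ` K'') = S"
    proof
      show "(\<Union>g\<in>A. pgl_act g ` proj_class ` K'') \<subseteq> S" using actS K''(2) by (auto simp: S_def)
      show "S \<subseteq> (\<Union>g\<in>A. pgl_act g ` proj_class ` K'')"
      proof
        fix s assume s: "s \<in> S"
        then obtain z where z: "z \<in> Z" "s = proj_class z" by (auto simp: S_def)
        obtain L where L: "L \<in> lifts A" "L *v z \<in> K''" using cocZ z(1) by blast
        have "proj_class (matrix_inv L) \<in> A" using lifts_inv[OF sA L(1)] by (simp add: lifts_def)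
        moreover have "s = pgl_act (proj_class (matrix_inv L)) (proj_class (L *v z))"
          using act_inv[OF L(1) s] z(2) by (simp add: pgl_act_proj_class)
        ultimately show "s \<in> (\<Union>g\<in>A. pgl_act g ` proj_class ` K'')" using L(2) by blast
      qed
    qed
  qed
  moreover have "pgl_act a p = p" if a: "a \<in> A" and p: "p \<in> simplex_vertices S" for a p
  proof -
    \<comment> \<open>The vertex may come from any representation N, J of S, not only from the
      constructed M, I.\<close>
    obtain N J i where N: "p = proj_class (N *v axis i 1)" "simplex_rep S N J" "i \<in> J"
      using p by (auto simp: simplex_vertices_def)
    obtain L where L: "L \<in> lifts A" "a = proj_class L" using lift[OF a] by blast
    show ?thesis
      using vertex_class_fixed[OF Z(1) lQ comm N(2)[unfolded S_def] N(3) L(1)] L(2) N(1)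
      by (simp add: pgl_act_proj_class)
  qed
  moreover have "\<exists>B. subgroup B pgl_group \<and> B \<subseteq> A \<and> finite {r_coset pgl_group B a | a. a \<in> A} \<and>
    pgl_group\<lparr>carrier := B\<rparr> \<cong> product_group {..<card I - 1} (\<lambda>_. integer_group)"
    by (rule simplex_lattice[OF disc sA AL abel lift M(1-3) ZQ M(4) K'' cocZ])
  ultimately show ?thesis using rep emb invS by blast
qed

end
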